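(* Let $A$ be a commutative ring containing $\mathbb{Q}$, let $B := A[[t_1, \ldots, t_n]]$, and let $\mathfrak{b} \subseteq B$ be the ideal generated by the variables $t_1, \ldots, t_n$. Suppose $M$ is a left $\mathcal{D}_{B/A}$-module, which is $\mathfrak{b}$-adically complete as a $B$-module. Then the canonical $A$-module homomorphism $M^{\mathrm{hor}} \to M/\mathfrak{b} \cdot M$ is bijective.
   Context: No finiteness condition is put on $A$ or on $M$. $\mathcal{D}_{B/A}$ is the ring of $A$-linear differential operators of $B$ in the sense of Grothendieck: an operator $\theta \in \mathrm{End}_A(B)$ has differential order $\leq 0$ if it is $B$-linear, and (for $k \geq 1$) order $\leq k$ if for every $b \in B$ the operator $[b,\theta] := b \cdot \theta - \theta \cdot b$ has order $\leq k-1$; $\mathcal{D}_{B/A}$ is the subring of $\mathrm{End}_A(B)$ of all operators of finite differential order. The operators of order $\leq 0$ form the subring $B$, so a left $\mathcal{D}_{B/A}$-module is in particular a $B$-module. Let $\partial_j := \partial/\partial t_j \in \mathcal{D}_{B/A}$. A $B$-module $M$ is $\mathfrak{b}$-adically complete if the canonical homomorphism $M \to \varprojlim_i M/\mathfrak{b}^i \cdot M$ is an isomorphism. The horizontal submodule of $M$ is the $A$-module $M^{\mathrm{hor}} := \{ m \in M \mid \partial_j(m) = 0 \text{ for all } j \}$. The canonical homomorphism $M^{\mathrm{hor}} \to M/\mathfrak{b} \cdot M$ is the composition of the inclusion $M^{\mathrm{hor}} \to M$ and the projection $M \to M/\mathfrak{b} \cdot M$. *)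

theory Defs
  imports "HOL-Algebra.Algebra" "HOL-Algebra.Algebraic_Closure_Type"
begin

section \<open>Rings containing the rationals\<close>

definition contains_rationals :: "('a, 'x) ring_scheme \<Rightarrow> bool" where
  "contains_rationals A \<longleftrightarrow>
     (\<exists>h \<in> ring_hom (ring_of_type_algebra :: rat ring) A. inj h)"


section \<open>Formal power series in finitely many variables\<close>

text \<open>As in \<^theory>\<open>HOL-Algebra.Indexed_Polynomials\<close>, a monomial is the multiset of the
  variables occurring in it, and a series maps each monomial to its coefficient.  The variables are
  indexed by \<open>1, \<dots>, n\<close>, so coefficients at monomials involving any other index vanish.\<close>

definition power_series ::
    "('a, 'x) ring_scheme \<Rightarrow> nat \<Rightarrow> ('a, nat multiset \<Rightarrow> 'a) module" where
  "power_series A n =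
     \<lparr>carrier = {f. (\<forall>m. f m \<in> carrier A) \<and> (\<forall>m. \<not> set_mset m \<subseteq> {1..n} \<longrightarrow> f m = \<zero>\<^bsub>A\<^esub>)},
      monoid.mult = (\<lambda>f g m. \<Oplus>\<^bsub>A\<^esub>c\<in>{c. c \<subseteq># m}. f c \<otimes>\<^bsub>A\<^esub> g (m - c)),
      one = ring.indexed_const A \<one>\<^bsub>A\<^esub>,
      ring.zero = (\<lambda>m. \<zero>\<^bsub>A\<^esub>),
      add = (\<lambda>f g m. f m \<oplus>\<^bsub>A\<^esub> g m),
      module.smult = (\<lambda>a f m. a \<otimes>\<^bsub>A\<^esub> f m)\<rparr>"

definition variable_ideal :: "('a, 'x) ring_scheme \<Rightarrow> nat \<Rightarrow> (nat multiset \<Rightarrow> 'a) set" where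
  "variable_ideal A n = genideal (power_series A n) (ring.indexed_var A ` {1..n})"

text \<open>\<open>\<partial>/\<partial>t\<^sub>j\<close> sends \<open>t\<^sup>m\<^sup>+\<^sup>e\<close>, where \<open>e\<close> is the \<open>j\<close>-th unit exponent, to \<open>(m\<^sub>j + 1) t\<^sup>m\<close>.\<close>

definition partial_derivative ::
    "('a, 'x) ring_scheme \<Rightarrow> nat \<Rightarrow> nat \<Rightarrow> (nat multiset \<Rightarrow> 'a) \<Rightarrow> (nat multiset \<Rightarrow> 'a)" where
  "partial_derivative A n j =
     (\<lambda>f\<in>carrier (power_series A n). \<lambda>m. add_pow A (Suc (count m j)) (f (add_mset j m)))"


section \<open>Differential operators\<close>

text \<open>In this section \<open>B\<close> is a commutative \<open>A\<close>-algebra.  Operators are extensional functions on the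
  carrier of \<open>B\<close>, so that equality of operators is equality of functions.\<close>

definition endomorphism_ring ::
    "('a, 'x) ring_scheme \<Rightarrow> ('a, 'b, 'y) module_scheme \<Rightarrow> ('b \<Rightarrow> 'b) ring" where
  "endomorphism_ring A B =
     \<lparr>carrier = {\<theta> \<in> carrier B \<rightarrow>\<^sub>E carrier B.
        (\<forall>x\<in>carrier B. \<forall>y\<in>carrier B. \<theta> (x \<oplus>\<^bsub>B\<^esub> y) = \<theta> x \<oplus>\<^bsub>B\<^esub> \<theta> y) \<and>
        (\<forall>a\<in>carrier A. \<forall>x\<in>carrier B. \<theta> (a \<odot>\<^bsub>B\<^esub> x) = a \<odot>\<^bsub>B\<^esub> \<theta> x)},
      monoid.mult = compose (carrier B),
      one = (\<lambda>x\<in>carrier B. x),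
      ring.zero = (\<lambda>x\<in>carrier B. \<zero>\<^bsub>B\<^esub>),
      add = (\<lambda>\<theta> \<phi>. \<lambda>x\<in>carrier B. \<theta> x \<oplus>\<^bsub>B\<^esub> \<phi> x)\<rparr>"

definition mult_operator :: "('b, 'y) ring_scheme \<Rightarrow> 'b \<Rightarrow> 'b \<Rightarrow> 'b" where
  "mult_operator B b = (\<lambda>x\<in>carrier B. b \<otimes>\<^bsub>B\<^esub> x)"

text \<open>The commutator \<open>[b, \<theta>] = b \<cdot> \<theta> - \<theta> \<cdot> b\<close>, evaluated pointwise.\<close>

definition operator_commutator :: "('b, 'y) ring_scheme \<Rightarrow> 'b \<Rightarrow> ('b \<Rightarrow> 'b) \<Rightarrow> 'b \<Rightarrow> 'b" where
  "operator_commutator B b \<theta> =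
     (\<lambda>x\<in>carrier B. b \<otimes>\<^bsub>B\<^esub> \<theta> x \<ominus>\<^bsub>B\<^esub> \<theta> (b \<otimes>\<^bsub>B\<^esub> x))"

primrec diff_operators_le ::
    "('a, 'x) ring_scheme \<Rightarrow> ('a, 'b, 'y) module_scheme \<Rightarrow> nat \<Rightarrow> ('b \<Rightarrow> 'b) set" where
  "diff_operators_le A B 0 =
     {\<theta> \<in> carrier (endomorphism_ring A B).
        \<forall>b\<in>carrier B. \<forall>x\<in>carrier B. \<theta> (b \<otimes>\<^bsub>B\<^esub> x) = b \<otimes>\<^bsub>B\<^esub> \<theta> x}"
| "diff_operators_le A B (Suc k) =
     {\<theta> \<in> carrier (endomorphism_ring A B).
        \<forall>b\<in>carrier B. operator_commutator B b \<theta> \<in> diff_operators_le A B k}"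

definition diff_operator_ring ::
    "('a, 'x) ring_scheme \<Rightarrow> ('a, 'b, 'y) module_scheme \<Rightarrow> ('b \<Rightarrow> 'b) ring" where
  "diff_operator_ring A B =
     (endomorphism_ring A B)\<lparr>carrier := (\<Union>k. diff_operators_le A B k)\<rparr>"


section \<open>Modules\<close>

text \<open>The library locale \<^locale>\<open>module\<close> requires a commutative ring of scalars.\<close>

locale left_module = R?: ring R + M?: abelian_group M
  for R :: "('r, 'x) ring_scheme" (structure) and M :: "('r, 'm, 'y) module_scheme" (structure) +
  assumes smult_closed:
      "\<lbrakk>a \<in> carrier R; x \<in> carrier M\<rbrakk> \<Longrightarrow> a \<odot>\<^bsub>M\<^esub> x \<in> carrier M"
    and smult_l_distr:
      "\<lbrakk>a \<in> carrier R; b \<in> carrier R; x \<in> carrier M\<rbrakk> \<Longrightarrow>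
       (a \<oplus> b) \<odot>\<^bsub>M\<^esub> x = a \<odot>\<^bsub>M\<^esub> x \<oplus>\<^bsub>M\<^esub> b \<odot>\<^bsub>M\<^esub> x"
    and smult_r_distr:
      "\<lbrakk>a \<in> carrier R; x \<in> carrier M; y \<in> carrier M\<rbrakk> \<Longrightarrow>
       a \<odot>\<^bsub>M\<^esub> (x \<oplus>\<^bsub>M\<^esub> y) = a \<odot>\<^bsub>M\<^esub> x \<oplus>\<^bsub>M\<^esub> a \<odot>\<^bsub>M\<^esub> y"
    and smult_assoc:
      "\<lbrakk>a \<in> carrier R; b \<in> carrier R; x \<in> carrier M\<rbrakk> \<Longrightarrow>
       (a \<otimes> b) \<odot>\<^bsub>M\<^esub> x = a \<odot>\<^bsub>M\<^esub> (b \<odot>\<^bsub>M\<^esub> x)"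
    and smult_one:
      "x \<in> carrier M \<Longrightarrow> \<one> \<odot>\<^bsub>M\<^esub> x = x"

text \<open>The ring fields \<^const>\<open>monoid.mult\<close> and \<^const>\<open>monoid.one\<close> of a module record play no role in a module
  that is not an algebra; they are left undefined below.\<close>

definition restrict_scalars ::
    "('b \<Rightarrow> 'd) \<Rightarrow> ('d, 'm, 'y) module_scheme \<Rightarrow> ('b, 'm) module" where
  "restrict_scalars \<phi> M =
     \<lparr>carrier = carrier M, monoid.mult = undefined, one = undefined,
      ring.zero = \<zero>\<^bsub>M\<^esub>, add = add M, module.smult = (\<lambda>b x. \<phi> b \<odot>\<^bsub>M\<^esub> x)\<rparr>"

definition quotient_module ::
    "('r, 'm, 'y) module_scheme \<Rightarrow> 'm set \<Rightarrow> ('r, 'm set) module" where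
  "quotient_module M N =
     \<lparr>carrier = a_rcosets\<^bsub>M\<^esub> N, monoid.mult = undefined, one = undefined,
      ring.zero = N, add = set_add M, module.smult = (\<lambda>r C. \<Union>x\<in>C. N +>\<^bsub>M\<^esub> (r \<odot>\<^bsub>M\<^esub> x))\<rparr>"

text \<open>The limit of \<open>\<dots> \<rightarrow> Q 2 \<rightarrow> Q 1 \<rightarrow> Q 0\<close> along \<open>\<pi> i : Q (i + 1) \<rightarrow> Q i\<close>.\<close>

definition inverse_limit_module ::
    "(nat \<Rightarrow> ('r, 'm) module) \<Rightarrow> (nat \<Rightarrow> 'm \<Rightarrow> 'm) \<Rightarrow> ('r, nat \<Rightarrow> 'm) module" where
  "inverse_limit_module Q \<pi> =
     \<lparr>carrier = {x. (\<forall>i. x i \<in> carrier (Q i)) \<and> (\<forall>i. \<pi> i (x (Suc i)) = x i)},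
      monoid.mult = undefined, one = undefined,
      ring.zero = (\<lambda>i. \<zero>\<^bsub>Q i\<^esub>), add = (\<lambda>x y i. x i \<oplus>\<^bsub>Q i\<^esub> y i), module.smult = (\<lambda>r x i. r \<odot>\<^bsub>Q i\<^esub> x i)\<rparr>"

definition module_iso ::
    "('r, 'x) ring_scheme \<Rightarrow> ('r, 'm, 'y) module_scheme \<Rightarrow> ('r, 'n, 'z) module_scheme \<Rightarrow> ('m \<Rightarrow> 'n) set"
  where
  "module_iso R M N =
     {h \<in> carrier M \<rightarrow> carrier N.
        (\<forall>x\<in>carrier M. \<forall>y\<in>carrier M. h (x \<oplus>\<^bsub>M\<^esub> y) = h x \<oplus>\<^bsub>N\<^esub> h y) \<and>
        (\<forall>r\<in>carrier R. \<forall>x\<in>carrier M. h (r \<odot>\<^bsub>M\<^esub> x) = r \<odot>\<^bsub>N\<^esub> h x) \<and>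
        bij_betw h (carrier M) (carrier N)}"


section \<open>Adic completeness\<close>

definition ideal_smult :: "'r set \<Rightarrow> ('r, 'm, 'y) module_scheme \<Rightarrow> 'm set" where
  "ideal_smult I M = generate (add_monoid M) {r \<odot>\<^bsub>M\<^esub> x | r x. r \<in> I \<and> x \<in> carrier M}"

text \<open>The ideal powers are those of the library's monoid \<^const>\<open>ideals_set\<close> of ideals under
  the ideal product; in particular the zeroth power of \<open>I\<close> is the whole ring.\<close>

definition adic_submodule ::
    "('r, 'x) ring_scheme \<Rightarrow> 'r set \<Rightarrow> ('r, 'm, 'y) module_scheme \<Rightarrow> nat \<Rightarrow> 'm set" where
  "adic_submodule R I M i = ideal_smult (I [^]\<^bsub>ideals_set R\<^esub> i) M"

text \<open>The transition map sends a coset \<open>x + I\<^sup>i\<^sup>+\<^sup>1M\<close> to \<open>x + I\<^sup>iM\<close>, which is the sum of the sets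
  \<open>I\<^sup>iM\<close> and \<open>x + I\<^sup>i\<^sup>+\<^sup>1M\<close>.\<close>

definition adic_completion ::
    "('r, 'x) ring_scheme \<Rightarrow> 'r set \<Rightarrow> ('r, 'm, 'y) module_scheme \<Rightarrow> ('r, nat \<Rightarrow> 'm set) module" where
  "adic_completion R I M =
     inverse_limit_module (\<lambda>i. quotient_module M (adic_submodule R I M i))
       (\<lambda>i C. adic_submodule R I M i <+>\<^bsub>M\<^esub> C)"

definition adically_complete ::
    "('r, 'x) ring_scheme \<Rightarrow> 'r set \<Rightarrow> ('r, 'm, 'y) module_scheme \<Rightarrow> bool" where
  "adically_complete R I M \<longleftrightarrow>
     (\<lambda>x i. adic_submodule R I M i +>\<^bsub>M\<^esub> x) \<in> module_iso R M (adic_completion R I M)"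


section \<open>Modules over the differential operators of a power series ring\<close>

abbreviation power_series_diff_ops ::
    "('a, 'x) ring_scheme \<Rightarrow> nat \<Rightarrow> ((nat multiset \<Rightarrow> 'a) \<Rightarrow> (nat multiset \<Rightarrow> 'a)) ring" where
  "power_series_diff_ops A n \<equiv> diff_operator_ring A (power_series A n)"

text \<open>A module over the differential operators, viewed as a module over the power series, each of
  which acts as its multiplication operator.\<close>

definition underlying_module ::
    "('a, 'x) ring_scheme \<Rightarrow> nat \<Rightarrow> ((nat multiset \<Rightarrow> 'a) \<Rightarrow> (nat multiset \<Rightarrow> 'a), 'm, 'y) module_scheme
      \<Rightarrow> (nat multiset \<Rightarrow> 'a, 'm) module" where
  "underlying_module A n M = restrict_scalars (mult_operator (power_series A n)) M"

definition horizontal ::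
    "('a, 'x) ring_scheme \<Rightarrow> nat \<Rightarrow> ((nat multiset \<Rightarrow> 'a) \<Rightarrow> (nat multiset \<Rightarrow> 'a), 'm, 'y) module_scheme
      \<Rightarrow> 'm set" where
  "horizontal A n M =
     {m \<in> carrier M. \<forall>j\<in>{1..n}. partial_derivative A n j \<odot>\<^bsub>M\<^esub> m = \<zero>\<^bsub>M\<^esub>}"

end

theory Submission
  imports Defs
begin

text \<open>For a single variable \<open>t\<close> with derivation \<open>\<partial>\<close>, the series
  \<open>E m = (\<Sum>i. (-t)\<^sup>i / i! \<cdot> \<partial>\<^sup>i m)\<close> converges \<open>\<bb>\<close>-adically, and telescoping its partial sums gives
  \<open>\<partial> (E m) = 0\<close> and \<open>E (t m) = 0\<close>.  Moreover \<open>E m\<close> is congruent to \<open>m\<close> modulo \<open>\<bb>M\<close>, and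
  \<open>E m = m\<close> if \<open>\<partial> m = 0\<close>.  The operators for different variables commute with each other's
  variables and derivations, so their composition is a projection onto the horizontal submodule
  that vanishes on \<open>\<bb>M\<close> and is the identity modulo \<open>\<bb>M\<close>.  Hence every class modulo \<open>\<bb>M\<close>
  contains exactly one horizontal element.\<close>

(* This notation clashes with the one for multiples, [k] \<cdot> x. *)
no_notation ideal_prod (infixl "\<cdot>\<index>" 80)

section \<open>Sums and cosets\<close>

text \<open>Identities for the infinite series are all read off from its finite partial sums, which
  have closed forms by two relations for p_i = (-t)^i / i!: the derivative of p_(i+1) is -p_i, and t
  p_i = -(i+1) p_(i+1). In either telescoping a single term with the factor p_k survives; it lies in
  b^k M and so disappears in the limit. The obstacle is that a derivation does not preserve b^k M.
  It lowers the adic order by at most one, which still allows passing to the limit and accounts for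
  the index shifts in the estimates. Both relations come from the one recurrence (i+1) c_(i+1) =
  -c_i for the coefficients of p_i = c_i t^i, and solving it is where the rationals enter. To
  annihilate bM it is enough to annihilate t_j m for all j and m, because these elements generate bM
  as an additive group. The differential operators act through the relation d_j b = b d_j + d_j(b)
  and the commutativity of the d_j.\<close>

lemma finite_submultisets: "finite {c. c \<subseteq># m}"
proof (induction m)
  case (add x m)
  have "{c. c \<subseteq># add_mset x m} \<subseteq> {c. c \<subseteq># m} \<union> add_mset x ` {c. c \<subseteq># m}"
  proof
    fix c
    assume "c \<in> {c. c \<subseteq># add_mset x m}"
    then have c: "c \<subseteq># add_mset x m"
      by simp
    show "c \<in> {c. c \<subseteq># m} \<union> add_mset x ` {c. c \<subseteq># m}"
    proof (cases "x \<in># c")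
      case True
      then obtain d where "c = add_mset x d"
        by (meson multi_member_split)
      with c show ?thesis
        by auto
    next
      case False
      with c show ?thesis
        by (metis UnI1 add_mset_add_single diff_single_trivial mem_Collect_eq subset_eq_diff_conv)
    qed
  qed
  then show ?case
    by (rule finite_subset) (use add.IH in simp)
qed simp

lemma diff_diff_submultiset: "c \<subseteq># m \<Longrightarrow> m - (m - c) = c"
  by (simp add: multiset_eq_iff subseteq_mset_def)

text \<open>Merging an iterated product into one over pairs allows two different iterations to be
  compared by one reindexing; in additive form this gives associativity of the Cauchy
  product.\<close>

lemma (in comm_monoid) finprod_Sigma:
  assumes "finite I" "\<And>i. i \<in> I \<Longrightarrow> finite (J i)"
    and "\<And>i j. i \<in> I \<Longrightarrow> j \<in> J i \<Longrightarrow> g i j \<in> carrier G"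
  shows "(\<Otimes>i\<in>I. \<Otimes>j\<in>J i. g i j) = (\<Otimes>p\<in>Sigma I J. g (fst p) (snd p))"
proof -
  have "(\<Otimes>p\<in>(\<Union>i\<in>I. Pair i ` J i). g (fst p) (snd p)) = (\<Otimes>i\<in>I. \<Otimes>p\<in>Pair i ` J i. g (fst p) (snd p))"
    by (rule finprod_UN_disjoint) (use assms in \<open>auto simp: pairwise_def disjnt_def\<close>)
  also have "\<dots> = (\<Otimes>i\<in>I. \<Otimes>j\<in>J i. g i j)"
  proof (rule finprod_cong')
    fix i
    assume i: "i \<in> I"
    then show "(\<Otimes>p\<in>Pair i ` J i. g (fst p) (snd p)) = (\<Otimes>j\<in>J i. g i j)"
      using assms(3)[OF i] by (subst finprod_reindex) (auto simp: inj_on_def)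
  qed (use assms in auto)
  also have "(\<Union>i\<in>I. Pair i ` J i) = Sigma I J"
    by auto
  finally show ?thesis ..
qed

text \<open>No finiteness is assumed: over an infinite index set both products take their default
  value, the unit.\<close>

lemma (in comm_monoid) nat_pow_finprod:
  assumes "\<And>i. i \<in> I \<Longrightarrow> g i \<in> carrier G"
  shows "(\<Otimes>i\<in>I. g i) [^] (k::nat) = (\<Otimes>i\<in>I. g i [^] k)"
  using assms
  by (induction I rule: infinite_finite_induct) (simp_all add: nat_pow_distrib Pi_def)

lemma (in abelian_group) add_add_minus_cancel:
  "x \<in> carrier G \<Longrightarrow> y \<in> carrier G \<Longrightarrow> x \<oplus> (y \<oplus> \<ominus> x) = y"
  by (simp add: a_lcomm[of x y] r_neg)

lemma (in abelian_group) minus_eq_zero_iff: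
  assumes "x \<in> carrier G" "y \<in> carrier G"
  shows "x \<ominus> y = \<zero> \<longleftrightarrow> x = y"
  using assms add.inv_equality[of x "\<ominus> y"] by (auto simp: minus_eq r_neg)

text \<open>The dictionary between the completion, which is built from cosets, and the estimates,
  which are about differences.\<close>

lemma (in abelian_group) coset_eq_iff_minus:
  assumes H: "subgroup H (add_monoid G)" and x: "x \<in> carrier G" and y: "y \<in> carrier G"
  shows "H +> x = H +> y \<longleftrightarrow> x \<ominus> y \<in> H"
proof -
  interpret H: abelian_subgroup H G
    using H by (intro abelian_subgroupI3 additive_subgroup.intro abelian_group_axioms)
  have "H +> x = H +> y \<longleftrightarrow> x \<in> H +> y"
    using H.a_rcos_self[OF x] a_repr_independence[OF _ y H] by auto
  also have "\<dots> \<longleftrightarrow> x \<ominus> y \<in> H"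
    using H.a_rcos_module[OF y x] by (simp add: minus_eq)
  finally show ?thesis .
qed

lemma (in module) smult_add_pow:
  assumes "r \<in> carrier R" "x \<in> carrier M"
  shows "r \<odot>\<^bsub>M\<^esub> ([(k::nat)] \<cdot>\<^bsub>M\<^esub> x) = ([k] \<cdot> r) \<odot>\<^bsub>M\<^esub> x"
  using assms by (induction k) (simp_all add: smult_r_distr smult_l_distr)

section \<open>The ring of power series\<close>

lemma power_series_simps:
  "f \<in> carrier (power_series R n) \<longleftrightarrow>
    (\<forall>m. f m \<in> carrier R) \<and> (\<forall>m. \<not> set_mset m \<subseteq> {1..n} \<longrightarrow> f m = \<zero>\<^bsub>R\<^esub>)"
  "f \<otimes>\<^bsub>power_series R n\<^esub> g = (\<lambda>m. \<Oplus>\<^bsub>R\<^esub>c\<in>{c. c \<subseteq># m}. f c \<otimes>\<^bsub>R\<^esub> g (m - c))"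
  "\<one>\<^bsub>power_series R n\<^esub> = ring.indexed_const R \<one>\<^bsub>R\<^esub>"
  "\<zero>\<^bsub>power_series R n\<^esub> = (\<lambda>m. \<zero>\<^bsub>R\<^esub>)"
  "f \<oplus>\<^bsub>power_series R n\<^esub> g = (\<lambda>m. f m \<oplus>\<^bsub>R\<^esub> g m)"
  "a \<odot>\<^bsub>power_series R n\<^esub> f = (\<lambda>m. a \<otimes>\<^bsub>R\<^esub> f m)"
  by (simp_all add: power_series_def)

context cring
begin

section \<open>Cauchy products of power series\<close>

lemma power_series_coeff_closed:
  "f \<in> carrier (power_series R n) \<Longrightarrow> f m \<in> carrier R"
  by (simp add: power_series_simps)

lemma power_series_coeff_zero:
  "f \<in> carrier (power_series R n) \<Longrightarrow> \<not> set_mset m \<subseteq> {1..n} \<Longrightarrow> f m = \<zero>"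
  by (simp add: power_series_simps)

lemma power_series_mult_closed:
  assumes "f \<in> carrier (power_series R n)" "g \<in> carrier (power_series R n)"
  shows "f \<otimes>\<^bsub>power_series R n\<^esub> g \<in> carrier (power_series R n)"
proof -
  note coeff = power_series_coeff_closed[OF assms(1)] power_series_coeff_closed[OF assms(2)]
  have "(\<Oplus>c\<in>{c. c \<subseteq># m}. f c \<otimes> g (m - c)) = \<zero>" if "\<not> set_mset m \<subseteq> {1..n}" for m
  proof (rule add.finprod_one_eqI)
    fix c
    assume "c \<in> {c. c \<subseteq># m}"
    \<comment> \<open>A variable with a forbidden index in \<open>m\<close> occurs in
      \<open>c\<close> or in \<open>m - c\<close>, so one of the two factors vanishes.\<close>
    then have "set_mset m = set_mset c \<union> set_mset (m - c)"
      by (metis mem_Collect_eq set_mset_union subset_mset.add_diff_inverse)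
    with that have "\<not> set_mset c \<subseteq> {1..n} \<or> \<not> set_mset (m - c) \<subseteq> {1..n}"
      by auto
    then show "f c \<otimes> g (m - c) = \<zero>"
      using power_series_coeff_zero assms coeff by (metis l_null r_null)
  qed
  with coeff show ?thesis
    by (auto simp: power_series_simps intro!: finsum_closed)
qed

lemma power_series_mult_comm:
  assumes "f \<in> carrier (power_series R n)" "g \<in> carrier (power_series R n)"
  shows "f \<otimes>\<^bsub>power_series R n\<^esub> g = g \<otimes>\<^bsub>power_series R n\<^esub> f"
proof
  fix m :: "nat multiset"
  note coeff = power_series_coeff_closed[OF assms(1)] power_series_coeff_closed[OF assms(2)]
  \<comment> \<open>Taking complements in \<open>m\<close> is an involution on the index set of the
    Cauchy product, and it exchanges the two factors.\<close>
  have flip: "(-) m ` {c. c \<subseteq># m} = {c. c \<subseteq># m}"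
  proof
    show "{c. c \<subseteq># m} \<subseteq> (-) m ` {c. c \<subseteq># m}"
    proof
      fix c
      assume "c \<in> {c. c \<subseteq># m}"
      then show "c \<in> (-) m ` {c. c \<subseteq># m}"
        by (intro image_eqI[of _ _ "m - c"]) (auto simp: multiset_eq_iff subseteq_mset_def)
    qed
  qed auto
  have "(\<Oplus>c\<in>{c. c \<subseteq># m}. f c \<otimes> g (m - c)) = (\<Oplus>c\<in>(-) m ` {c. c \<subseteq># m}. f c \<otimes> g (m - c))"
    by (simp only: flip)
  also have "\<dots> = (\<Oplus>c\<in>{c. c \<subseteq># m}. f (m - c) \<otimes> g (m - (m - c)))"
    using coeff by (subst finsum_reindex) (auto simp: inj_on_def, metis diff_diff_submultiset)
  also have "\<dots> = (\<Oplus>c\<in>{c. c \<subseteq># m}. g c \<otimes> f (m - c))"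
    using coeff by (intro finsum_cong') (auto simp: m_comm diff_diff_submultiset)
  finally show "(f \<otimes>\<^bsub>power_series R n\<^esub> g) m = (g \<otimes>\<^bsub>power_series R n\<^esub> f) m"
    by (simp add: power_series_simps)
qed

lemma power_series_mult_assoc:
  assumes "f \<in> carrier (power_series R n)" "g \<in> carrier (power_series R n)"
    "h \<in> carrier (power_series R n)"
  shows "(f \<otimes>\<^bsub>power_series R n\<^esub> g) \<otimes>\<^bsub>power_series R n\<^esub> h =
    f \<otimes>\<^bsub>power_series R n\<^esub> (g \<otimes>\<^bsub>power_series R n\<^esub> h)"
proof
  fix m :: "nat multiset"
  note coeff = power_series_coeff_closed[OF assms(1)] power_series_coeff_closed[OF assms(2)]
    power_series_coeff_closed[OF assms(3)]
  \<comment> \<open>Both bracketings run over the ways to split \<open>m\<close> into three parts. A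
    pair (d, e) lists the parts given to \<open>f\<close> and \<open>g\<close>; the left bracketing
    is instead indexed by (c, d) with c = d + e.\<close>
  let ?S = "Sigma {d. d \<subseteq># m} (\<lambda>d. {e. e \<subseteq># m - d})"
  let ?\<phi> = "\<lambda>(d, e). (d + e, d)"
  have image: "?\<phi> ` ?S = Sigma {c. c \<subseteq># m} (\<lambda>c. {d. d \<subseteq># c})"
  proof
    show "?\<phi> ` ?S \<subseteq> Sigma {c. c \<subseteq># m} (\<lambda>c. {d. d \<subseteq># c})"
      by (auto simp: subset_mset.le_diff_conv2 add.commute)
    show "Sigma {c. c \<subseteq># m} (\<lambda>c. {d. d \<subseteq># c}) \<subseteq> ?\<phi> ` ?S"
    proof clarify
      fix c d
      assume "c \<subseteq># m" "d \<subseteq># c"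
      then show "(c, d) \<in> ?\<phi> ` ?S"
        by (intro image_eqI[of _ _ "(d, c - d)"])
          (auto simp: subseteq_mset_def diff_le_mono multiset_eq_iff intro: order_trans)
    qed
  qed
  have "(\<Oplus>c\<in>{c. c \<subseteq># m}. (\<Oplus>d\<in>{d. d \<subseteq># c}. f d \<otimes> g (c - d)) \<otimes> h (m - c)) =
      (\<Oplus>c\<in>{c. c \<subseteq># m}. \<Oplus>d\<in>{d. d \<subseteq># c}. f d \<otimes> g (c - d) \<otimes> h (m - c))"
    using coeff by (intro finsum_cong' finsum_ldistr) (auto simp: finite_submultisets)
  also have "\<dots> = (\<Oplus>p\<in>?\<phi> ` ?S. f (snd p) \<otimes> g (fst p - snd p) \<otimes> h (m - fst p))"
    unfolding image using coeff
    by (intro add.finprod_Sigma[where g = "\<lambda>c d. f d \<otimes> g (c - d) \<otimes> h (m - c)"])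
      (auto simp: finite_submultisets)
  also have "\<dots> = (\<Oplus>p\<in>?S. f (fst p) \<otimes> (g (snd p) \<otimes> h (m - fst p - snd p)))"
    using coeff by (subst finsum_reindex)
      (auto simp: inj_on_def m_assoc diff_diff_add_mset intro!: finsum_cong')
  also have "\<dots> = (\<Oplus>d\<in>{d. d \<subseteq># m}. \<Oplus>e\<in>{e. e \<subseteq># m - d}. f d \<otimes> (g e \<otimes> h (m - d - e)))"
    using coeff
    by (intro add.finprod_Sigma[symmetric, where g = "\<lambda>d e. f d \<otimes> (g e \<otimes> h (m - d - e))"])
      (auto simp: finite_submultisets)
  also have "\<dots> = (\<Oplus>d\<in>{d. d \<subseteq># m}. f d \<otimes> (\<Oplus>e\<in>{e. e \<subseteq># m - d}. g e \<otimes> h (m - d - e)))"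
    using coeff by (intro finsum_cong' finsum_rdistr[symmetric]) (auto simp: finite_submultisets)
  finally show "((f \<otimes>\<^bsub>power_series R n\<^esub> g) \<otimes>\<^bsub>power_series R n\<^esub> h) m =
      (f \<otimes>\<^bsub>power_series R n\<^esub> (g \<otimes>\<^bsub>power_series R n\<^esub> h)) m"
    by (simp add: power_series_simps)
qed

text \<open>One shape for constants, variables and the Taylor coefficients c_i t_j^i, so that every
  explicit computation in the ring is one with single monomials.\<close>

definition monomial_series :: "'c multiset \<Rightarrow> 'a \<Rightarrow> 'c multiset \<Rightarrow> 'a" where
  "monomial_series k a = (\<lambda>m. if m = k then a else \<zero>)"

lemma monomial_series_closed:
  assumes "a \<in> carrier R" "set_mset k \<subseteq> {1..n}"
  shows "monomial_series k a \<in> carrier (power_series R n)"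
  using assms by (auto simp: monomial_series_def power_series_simps)

lemma indexed_const_eq_monomial: "indexed_const a = monomial_series {#} a"
  by (simp add: indexed_const_def monomial_series_def)

lemma indexed_var_eq_monomial: "indexed_var j = monomial_series {#j#} \<one>"
  by (rule ext)
    (auto simp: indexed_var_def indexed_pmult_def indexed_const_def monomial_series_def
      dest!: multi_member_split)

lemma monomial_series_mult:
  assumes "a \<in> carrier R" "f \<in> carrier (power_series R n)"
  shows "monomial_series k a \<otimes>\<^bsub>power_series R n\<^esub> f =
    (\<lambda>m. if k \<subseteq># m then a \<otimes> f (m - k) else \<zero>)"
proof
  fix m
  have "(\<Oplus>c\<in>{c. c \<subseteq># m}. monomial_series k a c \<otimes> f (m - c)) =
      (\<Oplus>c\<in>{c. c \<subseteq># m}. if k = c then a \<otimes> f (m - c) else \<zero>)"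
    using assms by (intro finsum_cong') (auto simp: monomial_series_def power_series_simps)
  also have "\<dots> = (if k \<subseteq># m then a \<otimes> f (m - k) else \<zero>)"
  proof (cases "k \<subseteq># m")
    case True
    then show ?thesis
      using assms finsum_singleton[of k "{c. c \<subseteq># m}" "\<lambda>c. a \<otimes> f (m - c)"]
      by (simp add: finite_submultisets power_series_simps)
  next
    case False
    then show ?thesis
      by (auto intro!: add.finprod_one_eqI)
  qed
  finally show "(monomial_series k a \<otimes>\<^bsub>power_series R n\<^esub> f) m =
      (if k \<subseteq># m then a \<otimes> f (m - k) else \<zero>)"
    by (simp add: power_series_simps)
qed

lemma monomial_series_mult_monomial:
  assumes "a \<in> carrier R" "b \<in> carrier R" "set_mset l \<subseteq> {1..n}"
  shows "monomial_series k a \<otimes>\<^bsub>power_series R n\<^esub> monomial_series l b =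
    monomial_series (k + l) (a \<otimes> b)"
proof -
  have "monomial_series k a \<otimes>\<^bsub>power_series R n\<^esub> monomial_series l b =
      (\<lambda>m. if k \<subseteq># m then a \<otimes> monomial_series l b (m - k) else \<zero>)"
    using assms by (intro monomial_series_mult monomial_series_closed)
  also have "\<dots> = monomial_series (k + l) (a \<otimes> b)"
    using assms by (auto simp: monomial_series_def fun_eq_iff)
  finally show ?thesis .
qed

lemma power_series_cring: "cring (power_series R n)"
proof (rule cringI)
  show "abelian_group (power_series R n)"
  proof (rule abelian_groupI)
    fix f
    assume "f \<in> carrier (power_series R n)"
    then show "\<exists>g\<in>carrier (power_series R n). g \<oplus>\<^bsub>power_series R n\<^esub> f = \<zero>\<^bsub>power_series R n\<^esub>"
      by (intro bexI[of _ "\<lambda>m. \<ominus> f m"]) (auto simp: power_series_simps l_neg)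
  qed (auto simp: power_series_simps a_ac)
  show "comm_monoid (power_series R n)"
  proof (rule comm_monoidI)
    show "\<one>\<^bsub>power_series R n\<^esub> \<in> carrier (power_series R n)"
      by (simp add: power_series_simps(3) indexed_const_eq_monomial monomial_series_closed)
    fix f
    assume "f \<in> carrier (power_series R n)"
    then show "\<one>\<^bsub>power_series R n\<^esub> \<otimes>\<^bsub>power_series R n\<^esub> f = f"
      using monomial_series_mult[of \<one> f n "{#}"]
      by (simp add: power_series_simps(3) indexed_const_eq_monomial power_series_coeff_closed)
  qed (use power_series_mult_closed power_series_mult_comm power_series_mult_assoc in auto)
  fix f g h
  assume *: "f \<in> carrier (power_series R n)" "g \<in> carrier (power_series R n)"
    "h \<in> carrier (power_series R n)"
  then show "(f \<oplus>\<^bsub>power_series R n\<^esub> g) \<otimes>\<^bsub>power_series R n\<^esub> h =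
    f \<otimes>\<^bsub>power_series R n\<^esub> h \<oplus>\<^bsub>power_series R n\<^esub> g \<otimes>\<^bsub>power_series R n\<^esub> h"
    by (simp add: power_series_simps l_distr add.finprod_multf Pi_def)
qed

text \<open>Scalars become constant series; linearity over the base ring is thereby reduced to the
  ring laws and, for derivations, to the Leibniz rule.\<close>

lemma power_series_smult_eq_mult:
  assumes "a \<in> carrier R" "f \<in> carrier (power_series R n)"
  shows "a \<odot>\<^bsub>power_series R n\<^esub> f = monomial_series {#} a \<otimes>\<^bsub>power_series R n\<^esub> f"
  using monomial_series_mult[OF assms, of "{#}"] by (simp add: power_series_simps)

section \<open>Partial derivatives of power series\<close>

lemma partial_derivative_apply:
  "f \<in> carrier (power_series R n) \<Longrightarrow>
    partial_derivative R n j f = (\<lambda>m. [Suc (count m j)] \<cdot> f (add_mset j m))"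
  by (simp add: partial_derivative_def)

lemma partial_derivative_closed:
  assumes "f \<in> carrier (power_series R n)"
  shows "partial_derivative R n j f \<in> carrier (power_series R n)"
  using assms by (auto simp: partial_derivative_apply power_series_simps)

lemma partial_derivative_add:
  assumes "f \<in> carrier (power_series R n)" "g \<in> carrier (power_series R n)"
  shows "partial_derivative R n j (f \<oplus>\<^bsub>power_series R n\<^esub> g) =
    partial_derivative R n j f \<oplus>\<^bsub>power_series R n\<^esub> partial_derivative R n j g"
proof -
  interpret B: cring "power_series R n"
    by (rule power_series_cring)
  have "f \<oplus>\<^bsub>power_series R n\<^esub> g \<in> carrier (power_series R n)"
    using assms by simp
  with assms show ?thesis
    by (simp add: partial_derivative_apply power_series_simps(5)
        power_series_coeff_closed add.nat_pow_distrib del: add.nat_pow_Suc)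
qed

lemma partial_derivative_monomial:
  assumes "a \<in> carrier R" "set_mset k \<subseteq> {1..n}" "j \<in> {1..n}"
  shows "partial_derivative R n j (monomial_series (add_mset j k) a) =
    monomial_series k ([Suc (count k j)] \<cdot> a)"
  using assms
  by (subst partial_derivative_apply[OF monomial_series_closed])
    (auto simp: monomial_series_def fun_eq_iff simp del: add.nat_pow_Suc)

lemma partial_derivative_monomial_zero:
  assumes "a \<in> carrier R" "set_mset k \<subseteq> {1..n}" "j \<notin># k"
  shows "partial_derivative R n j (monomial_series k a) = \<zero>\<^bsub>power_series R n\<^esub>"
  using assms
  by (subst partial_derivative_apply[OF monomial_series_closed])
    (auto simp: monomial_series_def fun_eq_iff power_series_simps(4) simp del: add.nat_pow_Suc)

text \<open>For distinct \<open>i\<close> and \<open>j\<close>, adding one variable leaves the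
  exponent of the other alone, so either order yields the factor (m_i + 1)(m_j + 1) in front of the
  same coefficient.\<close>

lemma partial_derivative_commute:
  assumes "f \<in> carrier (power_series R n)"
  shows "partial_derivative R n i (partial_derivative R n j f) =
    partial_derivative R n j (partial_derivative R n i f)"
proof (cases "i = j")
  case False
  note closed = partial_derivative_closed[OF assms]
  from False assms show ?thesis
    unfolding partial_derivative_apply[OF closed] unfolding partial_derivative_apply[OF assms]
    by (simp add: fun_eq_iff add_mset_commute power_series_coeff_closed
          add.nat_pow_pow mult.commute del: add.nat_pow_Suc mult_Suc mult_Suc_right)
qed simp

text \<open>When m + e_j is split into two parts, the factor m_j + 1 is the sum of their exponents
  at \<open>j\<close>. Distributing it accordingly gives the two sums of the product rule
  (\<open>left\<close> and \<open>right\<close> below), after terms with exponent zero are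
  dropped.\<close>

lemma partial_derivative_mult:
  assumes "f \<in> carrier (power_series R n)" "g \<in> carrier (power_series R n)"
  shows "partial_derivative R n j (f \<otimes>\<^bsub>power_series R n\<^esub> g) =
    partial_derivative R n j f \<otimes>\<^bsub>power_series R n\<^esub> g \<oplus>\<^bsub>power_series R n\<^esub>
    f \<otimes>\<^bsub>power_series R n\<^esub> partial_derivative R n j g"
proof
  fix m
  let ?m = "add_mset j m"
  note coeff [simp] = power_series_coeff_closed[OF assms(1)] power_series_coeff_closed[OF assms(2)]
  note [simp] = finite_submultisets
  note [simp del] = add.nat_pow_Suc
  have split: "[Suc (count m j)] \<cdot> (f c \<otimes> g (?m - c)) =
      [count c j] \<cdot> (f c \<otimes> g (?m - c)) \<oplus> [count (?m - c) j] \<cdot> (f c \<otimes> g (?m - c))"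
    if "c \<subseteq># ?m" for c
  proof -
    have "Suc (count m j) = count c j + count (?m - c) j"
      using mset_subset_eq_count[OF that, of j] by simp
    then show ?thesis
      by (simp add: add.nat_pow_mult)
  qed
  have left: "(\<Oplus>c\<in>{c. c \<subseteq># ?m}. [count c j] \<cdot> (f c \<otimes> g (?m - c))) =
      (\<Oplus>c\<in>{c. c \<subseteq># m}. [Suc (count c j)] \<cdot> f (add_mset j c) \<otimes> g (m - c))"
  proof -
    have "(\<Oplus>c\<in>{c. c \<subseteq># ?m}. [count c j] \<cdot> (f c \<otimes> g (?m - c))) =
        (\<Oplus>c\<in>add_mset j ` {c. c \<subseteq># m}. [count c j] \<cdot> (f c \<otimes> g (?m - c)))"
    proof (rule add.finprod_mono_neutral_cong_right)
      fix c
      assume c: "c \<in> {c. c \<subseteq># ?m} - add_mset j ` {c. c \<subseteq># m}"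
      \<comment> \<open>An index \<open>c\<close> that does not arise by adding \<open>j\<close> to
        a submultiset of \<open>m\<close> has exponent zero at \<open>j\<close>, so its term drops
        out.\<close>
      have "j \<notin># c"
      proof
        assume "j \<in># c"
        then obtain d where "c = add_mset j d"
          by (meson multi_member_split)
        with c show False
          by auto
      qed
      then show "[count c j] \<cdot> (f c \<otimes> g (?m - c)) = \<zero>"
        by (simp add: not_in_iff)
    qed auto
    also have "\<dots> = (\<Oplus>c\<in>{c. c \<subseteq># m}. [Suc (count c j)] \<cdot> f (add_mset j c) \<otimes> g (m - c))"
      by (subst finsum_reindex) (auto simp: inj_on_def add_pow_ldistr intro!: finsum_cong')
    finally show ?thesis .
  qed
  have right: "(\<Oplus>c\<in>{c. c \<subseteq># ?m}. [count (?m - c) j] \<cdot> (f c \<otimes> g (?m - c))) =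
      (\<Oplus>c\<in>{c. c \<subseteq># m}. f c \<otimes> [Suc (count (m - c) j)] \<cdot> g (add_mset j (m - c)))"
  proof (rule add.finprod_mono_neutral_cong_right)
    show "{c. c \<subseteq># m} \<subseteq> {c. c \<subseteq># ?m}"
      by (auto intro: subset_mset.order_trans)
    fix c
    assume "c \<in> {c. c \<subseteq># ?m} - {c. c \<subseteq># m}"
    then have c: "c \<subseteq># ?m" "\<not> c \<subseteq># m"
      by auto
    \<comment> \<open>A part of m + e_j that does not fit into \<open>m\<close> must use up all m_j
      + 1 copies of \<open>j\<close>, leaving none for the second factor.\<close>
    have "count (?m - c) j = 0"
    proof (rule ccontr)
      assume "count (?m - c) j \<noteq> 0"
      then have "count c j \<le> count m j"
        by auto
      moreover have "count c x \<le> count m x" if "x \<noteq> j" for x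
        using mset_subset_eq_count[OF c(1), of x] that by simp
      ultimately have "c \<subseteq># m"
        unfolding subseteq_mset_def by metis
      with c(2) show False ..
    qed
    then show "[count (?m - c) j] \<cdot> (f c \<otimes> g (?m - c)) = \<zero>"
      by simp
  next
    fix c
    assume "c \<in> {c. c \<subseteq># m}"
    then have c: "c \<subseteq># m"
      by simp
    then have m: "?m - c = add_mset j (m - c)"
      by (simp add: multiset_eq_iff subseteq_mset_def Suc_diff_le)
    show "[count (?m - c) j] \<cdot> (f c \<otimes> g (?m - c)) =
        f c \<otimes> [Suc (count (m - c) j)] \<cdot> g (add_mset j (m - c))"
      unfolding m by (simp add: add_pow_rdistr del: count_diff)
  qed auto
  have "[Suc (count m j)] \<cdot> (\<Oplus>c\<in>{c. c \<subseteq># ?m}. f c \<otimes> g (?m - c)) =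
      (\<Oplus>c\<in>{c. c \<subseteq># ?m}. [Suc (count m j)] \<cdot> (f c \<otimes> g (?m - c)))"
    by (intro add.nat_pow_finprod) auto
  also have "\<dots> = (\<Oplus>c\<in>{c. c \<subseteq># ?m}.
      [count c j] \<cdot> (f c \<otimes> g (?m - c)) \<oplus> [count (?m - c) j] \<cdot> (f c \<otimes> g (?m - c)))"
    by (intro finsum_cong') (auto simp: split simp del: count_diff)
  also have "\<dots> = (\<Oplus>c\<in>{c. c \<subseteq># m}. [Suc (count c j)] \<cdot> f (add_mset j c) \<otimes> g (m - c)) \<oplus>
      (\<Oplus>c\<in>{c. c \<subseteq># m}. f c \<otimes> [Suc (count (m - c) j)] \<cdot> g (add_mset j (m - c)))"
    by (subst add.finprod_multf) (auto simp: left right simp del: count_diff)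
  finally show "partial_derivative R n j (f \<otimes>\<^bsub>power_series R n\<^esub> g) m =
      (partial_derivative R n j f \<otimes>\<^bsub>power_series R n\<^esub> g \<oplus>\<^bsub>power_series R n\<^esub>
       f \<otimes>\<^bsub>power_series R n\<^esub> partial_derivative R n j g) m"
    using assms
    by (simp add: partial_derivative_apply power_series_mult_closed)
      (simp add: power_series_simps(2,5))
qed

end

section \<open>Taylor projections on complete filtered modules\<close>

text \<open>\<open>F k\<close> stands for b^k M. Completeness is stated with an explicit rate:
  increments in \<open>F k\<close> give a limit that differs from the k-th term by an element of
  \<open>F k\<close>. This makes limits accessible by congruences alone, without a topology.\<close>

locale complete_filtered_module = module R M for R (structure) and M (structure) +
  fixes F :: "nat \<Rightarrow> 'c set"
  assumes F_submodule: "submodule (F k) R M"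
    and F_decreasing: "F (Suc k) \<subseteq> F k"
    and F_separated: "x \<in> carrier M \<Longrightarrow> (\<And>k. x \<in> F k) \<Longrightarrow> x = \<zero>\<^bsub>M\<^esub>"
    and F_complete: "(\<And>k. xs k \<in> carrier M) \<Longrightarrow> (\<And>k. xs (Suc k) \<ominus>\<^bsub>M\<^esub> xs k \<in> F k) \<Longrightarrow>
      \<exists>x\<in>carrier M. \<forall>k. x \<ominus>\<^bsub>M\<^esub> xs k \<in> F k"
begin

text \<open>Congruence modulo \<open>F k\<close>, with membership in the carrier built in so that
  chains of congruences supply their own side conditions.\<close>

definition close :: "nat \<Rightarrow> 'c \<Rightarrow> 'c \<Rightarrow> bool" where
  "close k x y \<longleftrightarrow> x \<in> carrier M \<and> y \<in> carrier M \<and> x \<ominus>\<^bsub>M\<^esub> y \<in> F k"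

section \<open>Congruences modulo the filtration\<close>

lemma F_carrier: "x \<in> F k \<Longrightarrow> x \<in> carrier M"
  using submoduleE(1)[OF F_submodule] by blast

lemma F_zero: "\<zero>\<^bsub>M\<^esub> \<in> F k"
  using subgroup.one_closed[OF submodule.axioms(1)[OF F_submodule]] by simp

lemma close_refl: "x \<in> carrier M \<Longrightarrow> close k x x"
  by (simp add: close_def F_zero M.minus_eq M.r_neg)

lemma close_sym:
  assumes "close k x y"
  shows "close k y x"
proof -
  have "y \<ominus>\<^bsub>M\<^esub> x = \<ominus>\<^bsub>M\<^esub> (x \<ominus>\<^bsub>M\<^esub> y)"
    using assms by (simp add: close_def M.minus_eq M.minus_add M.a_comm)
  with assms submoduleE(3)[OF F_submodule] show ?thesis
    by (simp add: close_def)
qed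

lemma close_trans:
  assumes "close k x y" "close k y z"
  shows "close k x z"
proof -
  have "x \<ominus>\<^bsub>M\<^esub> z = (x \<ominus>\<^bsub>M\<^esub> y) \<oplus>\<^bsub>M\<^esub> (y \<ominus>\<^bsub>M\<^esub> z)"
    using assms by (simp add: close_def M.minus_eq M.a_assoc M.r_neg1)
  with assms submoduleE(5)[OF F_submodule] show ?thesis
    by (simp add: close_def)
qed

lemma close_add:
  assumes "close k x y" "close k x' y'"
  shows "close k (x \<oplus>\<^bsub>M\<^esub> x') (y \<oplus>\<^bsub>M\<^esub> y')"
proof -
  have "(x \<oplus>\<^bsub>M\<^esub> x') \<ominus>\<^bsub>M\<^esub> (y \<oplus>\<^bsub>M\<^esub> y') = (x \<ominus>\<^bsub>M\<^esub> y) \<oplus>\<^bsub>M\<^esub> (x' \<ominus>\<^bsub>M\<^esub> y')"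
    using assms by (simp add: close_def M.minus_eq M.minus_add M.a_ac)
  with assms submoduleE(5)[OF F_submodule] show ?thesis
    by (simp add: close_def)
qed

lemma close_zero_iff:
  assumes "x \<in> carrier M"
  shows "close k x \<zero>\<^bsub>M\<^esub> \<longleftrightarrow> x \<in> F k"
proof -
  have minus_zero: "\<ominus>\<^bsub>M\<^esub> \<zero>\<^bsub>M\<^esub> = \<zero>\<^bsub>M\<^esub>"
    by (rule M.minus_equality) auto
  from assms show ?thesis
    by (simp add: close_def M.minus_eq minus_zero)
qed

lemma close_Suc: "close (Suc k) x y \<Longrightarrow> close k x y"
  using F_decreasing by (auto simp: close_def)

text \<open>By additivity the difference of the values is the value at the difference. The loss of
  one step is what a derivation costs.\<close>

lemma close_additive:
  assumes "\<And>x. x \<in> carrier M \<Longrightarrow> f x \<in> carrier M"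
    and "\<And>x y. x \<in> carrier M \<Longrightarrow> y \<in> carrier M \<Longrightarrow> f (x \<oplus>\<^bsub>M\<^esub> y) = f x \<oplus>\<^bsub>M\<^esub> f y"
    and "\<And>x. x \<in> F (Suc k) \<Longrightarrow> f x \<in> F k"
    and "close (Suc k) x y"
  shows "close k (f x) (f y)"
proof -
  have xy: "x \<in> carrier M" "y \<in> carrier M" "x \<ominus>\<^bsub>M\<^esub> y \<in> F (Suc k)"
    using assms(4) by (auto simp: close_def)
  then have "f ((x \<ominus>\<^bsub>M\<^esub> y) \<oplus>\<^bsub>M\<^esub> y) = f (x \<ominus>\<^bsub>M\<^esub> y) \<oplus>\<^bsub>M\<^esub> f y"
    by (intro assms(2)) auto
  moreover have "(x \<ominus>\<^bsub>M\<^esub> y) \<oplus>\<^bsub>M\<^esub> y = x"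
    using xy by (simp add: M.minus_eq M.a_assoc M.l_neg)
  ultimately have "f x = f (x \<ominus>\<^bsub>M\<^esub> y) \<oplus>\<^bsub>M\<^esub> f y"
    by simp
  then have "f x \<ominus>\<^bsub>M\<^esub> f y = f (x \<ominus>\<^bsub>M\<^esub> y)"
    using xy assms(1) by (simp add: M.minus_eq M.a_assoc M.r_neg)
  with xy assms(1,3) show ?thesis
    by (simp add: close_def)
qed

lemma eq_if_close:
  assumes "\<And>k. close k x y"
  shows "x = y"
proof -
  have "x \<in> carrier M" "y \<in> carrier M" "\<And>k. x \<ominus>\<^bsub>M\<^esub> y \<in> F k"
    using assms by (auto simp: close_def)
  then show ?thesis
    using F_separated[of "x \<ominus>\<^bsub>M\<^esub> y"] by (simp add: M.minus_eq_zero_iff)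
qed

text \<open>The sum has the \<open>k\<close> terms with index below \<open>k\<close>. Hence the
  first omitted term, with coefficient \<open>p k\<close>, already lies in \<open>F k\<close>, which
  matches the rate in \<open>F_complete\<close>.\<close>

primrec taylor_sum :: "('c \<Rightarrow> 'c) \<Rightarrow> (nat \<Rightarrow> 'a) \<Rightarrow> nat \<Rightarrow> 'c \<Rightarrow> 'c" where
  "taylor_sum D p 0 x = \<zero>\<^bsub>M\<^esub>"
| "taylor_sum D p (Suc k) x = taylor_sum D p k x \<oplus>\<^bsub>M\<^esub> p k \<odot>\<^bsub>M\<^esub> (D ^^ k) x"

text \<open>The limit of the partial sums; existence and uniqueness, which justify the description,
  are established in \<open>close_taylor\<close>.\<close>

definition taylor :: "('c \<Rightarrow> 'c) \<Rightarrow> (nat \<Rightarrow> 'a) \<Rightarrow> 'c \<Rightarrow> 'c" where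
  "taylor D p x = (THE y. \<forall>k. close k y (taylor_sum D p k x))"

end

text \<open>In the intended instance \<open>t\<close> is a variable, \<open>\<delta>\<close> and \<open>D\<close> are the partial derivatives with
  respect to it on the ring and on the module, and \<open>p i = (-t)\<^sup>i / i!\<close>.  Then \<open>taylor D p x\<close> is the
  Taylor series of \<open>x\<close> evaluated at \<open>t = 0\<close>.\<close>

locale module_coordinate = complete_filtered_module R M F
  for R (structure) and M (structure) and F +
  fixes \<delta> :: "'a \<Rightarrow> 'a" and D :: "'c \<Rightarrow> 'c" and t :: 'a and p :: "nat \<Rightarrow> 'a"
  assumes \<delta>_closed: "r \<in> carrier R \<Longrightarrow> \<delta> r \<in> carrier R"
    and D_closed: "x \<in> carrier M \<Longrightarrow> D x \<in> carrier M"
    and D_add: "x \<in> carrier M \<Longrightarrow> y \<in> carrier M \<Longrightarrow> D (x \<oplus>\<^bsub>M\<^esub> y) = D x \<oplus>\<^bsub>M\<^esub> D y"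
    and D_smult: "r \<in> carrier R \<Longrightarrow> x \<in> carrier M \<Longrightarrow>
      D (r \<odot>\<^bsub>M\<^esub> x) = r \<odot>\<^bsub>M\<^esub> D x \<oplus>\<^bsub>M\<^esub> \<delta> r \<odot>\<^bsub>M\<^esub> x"
    and D_F: "x \<in> F (Suc k) \<Longrightarrow> D x \<in> F k"
    and t_closed: "t \<in> carrier R"
    and \<delta>_t: "\<delta> t = \<one>"
    and p_closed: "p i \<in> carrier R"
    and p_0: "p 0 = \<one>"
    and \<delta>_p: "\<delta> (p (Suc i)) = \<ominus> p i"
    and p_t: "p i \<otimes> t = \<ominus> ([Suc i] \<cdot> p (Suc i))"
    and p_F: "x \<in> carrier M \<Longrightarrow> p i \<odot>\<^bsub>M\<^esub> x \<in> F i"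
begin

section \<open>Taylor sums and their limits in one variable\<close>

lemma D_pow_closed: "x \<in> carrier M \<Longrightarrow> (D ^^ k) x \<in> carrier M"
  by (induction k) (auto intro: D_closed)

lemma D_pow_add:
  "x \<in> carrier M \<Longrightarrow> y \<in> carrier M \<Longrightarrow> (D ^^ k) (x \<oplus>\<^bsub>M\<^esub> y) = (D ^^ k) x \<oplus>\<^bsub>M\<^esub> (D ^^ k) y"
  by (induction k) (simp_all add: D_add D_pow_closed)

lemma D_zero: "D \<zero>\<^bsub>M\<^esub> = \<zero>\<^bsub>M\<^esub>"
  using D_add[of "\<zero>\<^bsub>M\<^esub>" "\<zero>\<^bsub>M\<^esub>"] D_closed[of "\<zero>\<^bsub>M\<^esub>"] by (simp add: M.add.l_cancel_one')

lemma D_add_pow: "x \<in> carrier M \<Longrightarrow> D ([(k::nat)] \<cdot>\<^bsub>M\<^esub> x) = [k] \<cdot>\<^bsub>M\<^esub> D x"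
  by (induction k) (simp_all add: D_add D_zero D_closed)

text \<open>The commutator of D^(k+1) with \<open>t\<close> is (k+1) D^k, by induction from the case
  [D, t] = 1. Starting at \<open>Suc k\<close> avoids the exponent k - 1.\<close>

lemma D_pow_t:
  assumes "x \<in> carrier M"
  shows "(D ^^ Suc k) (t \<odot>\<^bsub>M\<^esub> x) = t \<odot>\<^bsub>M\<^esub> (D ^^ Suc k) x \<oplus>\<^bsub>M\<^esub> [Suc k] \<cdot>\<^bsub>M\<^esub> (D ^^ k) x"
proof (induction k)
  case 0
  with assms show ?case
    by (simp add: D_smult t_closed \<delta>_t D_closed smult_one)
next
  case (Suc k)
  have closed: "(D ^^ i) x \<in> carrier M" for i
    using assms by (rule D_pow_closed)
  have "(D ^^ Suc (Suc k)) (t \<odot>\<^bsub>M\<^esub> x) =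
      D (t \<odot>\<^bsub>M\<^esub> (D ^^ Suc k) x \<oplus>\<^bsub>M\<^esub> [Suc k] \<cdot>\<^bsub>M\<^esub> (D ^^ k) x)"
    using Suc by simp
  also have "\<dots> = t \<odot>\<^bsub>M\<^esub> (D ^^ Suc (Suc k)) x \<oplus>\<^bsub>M\<^esub> (D ^^ Suc k) x \<oplus>\<^bsub>M\<^esub>
      [Suc k] \<cdot>\<^bsub>M\<^esub> (D ^^ Suc k) x"
    using closed[of k] closed[of "Suc k"] closed[of "Suc (Suc k)"]
    by (simp add: D_add D_smult D_add_pow t_closed \<delta>_t smult_one del: M.add.nat_pow_Suc)
  also have "\<dots> = t \<odot>\<^bsub>M\<^esub> (D ^^ Suc (Suc k)) x \<oplus>\<^bsub>M\<^esub> [Suc (Suc k)] \<cdot>\<^bsub>M\<^esub> (D ^^ Suc k) x"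
    using closed[of "Suc k"] closed[of "Suc (Suc k)"] t_closed
    by (simp add: M.a_ac)
  finally show ?case .
qed

lemma taylor_sum_closed: "x \<in> carrier M \<Longrightarrow> taylor_sum D p k x \<in> carrier M"
  by (induction k) (simp_all add: D_pow_closed p_closed)

lemma taylor_sum_add:
  "x \<in> carrier M \<Longrightarrow> y \<in> carrier M \<Longrightarrow>
    taylor_sum D p k (x \<oplus>\<^bsub>M\<^esub> y) = taylor_sum D p k x \<oplus>\<^bsub>M\<^esub> taylor_sum D p k y"
  by (induction k)
    (simp_all add: D_pow_add D_pow_closed p_closed smult_r_distr taylor_sum_closed M.a_ac)

text \<open>By the Leibniz rule and \<open>\<delta>_p\<close>, the new summand contributes p_(k+1)
  D^(k+2) x - p_k D^(k+1) x, whose second term cancels the previous remainder.\<close>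

lemma D_taylor_sum:
  assumes "x \<in> carrier M"
  shows "D (taylor_sum D p (Suc k) x) = p k \<odot>\<^bsub>M\<^esub> (D ^^ Suc k) x"
proof (induction k)
  case 0
  with assms show ?case
    by (simp add: p_0 smult_one D_closed)
next
  case (Suc k)
  have closed: "(D ^^ i) x \<in> carrier M" for i
    using assms by (rule D_pow_closed)
  have "D (taylor_sum D p (Suc (Suc k)) x) =
      D (taylor_sum D p (Suc k) x) \<oplus>\<^bsub>M\<^esub> D (p (Suc k) \<odot>\<^bsub>M\<^esub> (D ^^ Suc k) x)"
    unfolding taylor_sum.simps(2)[of D p "Suc k"]
    by (intro D_add smult_closed p_closed closed taylor_sum_closed assms)
  also have "\<dots> = p k \<odot>\<^bsub>M\<^esub> (D ^^ Suc k) x \<oplus>\<^bsub>M\<^esub>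
      (p (Suc k) \<odot>\<^bsub>M\<^esub> (D ^^ Suc (Suc k)) x \<oplus>\<^bsub>M\<^esub> \<ominus>\<^bsub>M\<^esub> (p k \<odot>\<^bsub>M\<^esub> (D ^^ Suc k) x))"
    using closed[of "Suc k"] unfolding Suc
    by (simp add: D_smult \<delta>_p p_closed smult_l_minus)
  also have "\<dots> = p (Suc k) \<odot>\<^bsub>M\<^esub> (D ^^ Suc (Suc k)) x"
    using closed[of "Suc k"] closed[of "Suc (Suc k)"] p_closed
    by (simp add: M.add_add_minus_cancel)
  finally show ?case .
qed

text \<open>By \<open>D_pow_t\<close> the new summand is p_(k+1) t D^(k+1) x + (k+1) p_(k+1) D^k x;
  by \<open>p_t\<close> its second term is -p_k t D^k x and cancels the previous remainder.\<close>

lemma taylor_sum_t: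
  assumes "x \<in> carrier M"
  shows "taylor_sum D p (Suc k) (t \<odot>\<^bsub>M\<^esub> x) = p k \<odot>\<^bsub>M\<^esub> (t \<odot>\<^bsub>M\<^esub> (D ^^ k) x)"
proof (induction k)
  case 0
  with assms show ?case
    by (simp add: p_closed t_closed)
next
  case (Suc k)
  have closed: "(D ^^ i) x \<in> carrier M" for i
    using assms by (rule D_pow_closed)
  have "taylor_sum D p (Suc (Suc k)) (t \<odot>\<^bsub>M\<^esub> x) =
      p k \<odot>\<^bsub>M\<^esub> (t \<odot>\<^bsub>M\<^esub> (D ^^ k) x) \<oplus>\<^bsub>M\<^esub>
      p (Suc k) \<odot>\<^bsub>M\<^esub> (t \<odot>\<^bsub>M\<^esub> (D ^^ Suc k) x \<oplus>\<^bsub>M\<^esub> [Suc k] \<cdot>\<^bsub>M\<^esub> (D ^^ k) x)"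
    unfolding taylor_sum.simps(2)[of D p "Suc k"] Suc D_pow_t[OF assms] ..
  also have "\<dots> = p k \<odot>\<^bsub>M\<^esub> (t \<odot>\<^bsub>M\<^esub> (D ^^ k) x) \<oplus>\<^bsub>M\<^esub>
      (p (Suc k) \<odot>\<^bsub>M\<^esub> (t \<odot>\<^bsub>M\<^esub> (D ^^ Suc k) x) \<oplus>\<^bsub>M\<^esub>
       ([Suc k] \<cdot> p (Suc k)) \<odot>\<^bsub>M\<^esub> (D ^^ k) x)"
    using closed[of k] closed[of "Suc k"]
    by (simp add: smult_r_distr p_closed t_closed smult_add_pow
        del: M.add.nat_pow_Suc R.add.nat_pow_Suc)
  also have "[Suc k] \<cdot> p (Suc k) = \<ominus> (p k \<otimes> t)"
    by (simp add: p_t p_closed del: R.add.nat_pow_Suc)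
  also have "p k \<odot>\<^bsub>M\<^esub> (t \<odot>\<^bsub>M\<^esub> (D ^^ k) x) \<oplus>\<^bsub>M\<^esub>
      (p (Suc k) \<odot>\<^bsub>M\<^esub> (t \<odot>\<^bsub>M\<^esub> (D ^^ Suc k) x) \<oplus>\<^bsub>M\<^esub> \<ominus> (p k \<otimes> t) \<odot>\<^bsub>M\<^esub> (D ^^ k) x) =
      p (Suc k) \<odot>\<^bsub>M\<^esub> (t \<odot>\<^bsub>M\<^esub> (D ^^ Suc k) x)"
    using closed[of k] closed[of "Suc k"] p_closed t_closed
    by (simp add: smult_l_minus smult_assoc1 M.add_add_minus_cancel del: funpow.simps)
  finally show ?case .
qed

lemma taylor_sum_horizontal:
  assumes "x \<in> carrier M" "D x = \<zero>\<^bsub>M\<^esub>"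
  shows "taylor_sum D p (Suc k) x = x"
proof (induction k)
  case (Suc k)
  have "(D ^^ Suc k) x = \<zero>\<^bsub>M\<^esub>"
    using assms(2) by (induction k) (simp_all add: D_zero)
  with Suc assms show ?case
    unfolding taylor_sum.simps(2)[of D p "Suc k"] by (simp add: p_closed)
qed (use assms in \<open>simp add: p_0 smult_one\<close>)

text \<open>Consecutive partial sums differ by a multiple of \<open>p k\<close>, hence by an element
  of \<open>F k\<close>. Completeness yields a limit, and separatedness makes it unique.\<close>

lemma close_taylor:
  assumes x: "x \<in> carrier M"
  shows "close k (taylor D p x) (taylor_sum D p k x)"
proof -
  have "taylor_sum D p (Suc k) x \<ominus>\<^bsub>M\<^esub> taylor_sum D p k x = p k \<odot>\<^bsub>M\<^esub> (D ^^ k) x" for k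
    using x by (simp add: D_pow_closed p_closed taylor_sum_closed M.minus_eq M.a_comm M.r_neg1)
  then have "\<exists>y\<in>carrier M. \<forall>k. y \<ominus>\<^bsub>M\<^esub> taylor_sum D p k x \<in> F k"
    using x by (intro F_complete) (auto intro: taylor_sum_closed p_F D_pow_closed)
  then obtain y where y: "close k y (taylor_sum D p k x)" for k
    using x by (auto simp: close_def taylor_sum_closed)
  have "\<exists>!y. \<forall>k. close k y (taylor_sum D p k x)"
  proof (rule ex1I[of _ y])
    fix z
    assume "\<forall>k. close k z (taylor_sum D p k x)"
    with y show "z = y"
      by (intro eq_if_close) (blast intro: close_sym close_trans)
  qed (use y in blast)
  from theI'[OF this] show ?thesis
    unfolding taylor_def by blast
qed

lemma taylor_closed: "x \<in> carrier M \<Longrightarrow> taylor D p x \<in> carrier M"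
  using close_taylor by (auto simp: close_def)

text \<open>The criterion used for the identities of the limit. Comparing with index
  \<open>Suc k\<close> modulo \<open>F k\<close> reaches the closed forms, which hold for nonempty
  sums, and leaves room for a map that loses one step of the filtration.\<close>

lemma taylor_eqI:
  assumes "x \<in> carrier M" "\<And>k. close k y (taylor_sum D p (Suc k) x)"
  shows "taylor D p x = y"
proof (rule eq_if_close)
  fix k
  have "close k (taylor D p x) (taylor_sum D p (Suc k) x)"
    by (rule close_Suc[OF close_taylor[OF assms(1)]])
  then show "close k (taylor D p x) y"
    using assms(2) close_sym close_trans by blast
qed

lemma taylor_add:
  assumes "x \<in> carrier M" "y \<in> carrier M"
  shows "taylor D p (x \<oplus>\<^bsub>M\<^esub> y) = taylor D p x \<oplus>\<^bsub>M\<^esub> taylor D p y"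
proof (rule taylor_eqI)
  fix k
  show "close k (taylor D p x \<oplus>\<^bsub>M\<^esub> taylor D p y) (taylor_sum D p (Suc k) (x \<oplus>\<^bsub>M\<^esub> y))"
    unfolding taylor_sum_add[OF assms]
    by (intro close_add close_Suc[OF close_taylor] assms)
qed (use assms in simp)

text \<open>\<open>D\<close> of the limit is congruent modulo \<open>F k\<close> to \<open>D\<close>
  of the (k+1)-st partial sum, which by telescoping is a multiple of \<open>p k\<close> and so
  congruent to zero.\<close>

lemma D_taylor:
  assumes "x \<in> carrier M"
  shows "D (taylor D p x) = \<zero>\<^bsub>M\<^esub>"
proof (rule eq_if_close)
  fix k
  have "close k (D (taylor D p x)) (D (taylor_sum D p (Suc k) x))"
    by (intro close_additive[of D] D_closed D_add D_F close_taylor assms)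
  moreover have "close k (D (taylor_sum D p (Suc k) x)) \<zero>\<^bsub>M\<^esub>"
    unfolding D_taylor_sum[OF assms] using D_pow_closed[OF assms, of "Suc k"] p_closed
    by (subst close_zero_iff) (auto intro: p_F simp del: funpow.simps)
  ultimately show "close k (D (taylor D p x)) \<zero>\<^bsub>M\<^esub>"
    by (rule close_trans)
qed

lemma taylor_t:
  assumes "x \<in> carrier M"
  shows "taylor D p (t \<odot>\<^bsub>M\<^esub> x) = \<zero>\<^bsub>M\<^esub>"
proof (rule taylor_eqI)
  fix k
  have "t \<odot>\<^bsub>M\<^esub> (D ^^ k) x \<in> carrier M"
    using assms by (simp add: t_closed D_pow_closed)
  then have "p k \<odot>\<^bsub>M\<^esub> (t \<odot>\<^bsub>M\<^esub> (D ^^ k) x) \<in> F k"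
    by (rule p_F)
  then show "close k \<zero>\<^bsub>M\<^esub> (taylor_sum D p (Suc k) (t \<odot>\<^bsub>M\<^esub> x))"
    unfolding taylor_sum_t[OF assms] using F_carrier close_sym close_zero_iff by blast
qed (use assms t_closed in simp)

lemma taylor_horizontal:
  assumes "x \<in> carrier M" "D x = \<zero>\<^bsub>M\<^esub>"
  shows "taylor D p x = x"
  using assms by (intro taylor_eqI) (simp_all only: taylor_sum_horizontal close_refl)

text \<open>The partial sum with one term is \<open>x\<close> itself, because \<open>p 0\<close> is
  the unit.\<close>

lemma close_taylor_self:
  assumes "x \<in> carrier M"
  shows "close 1 (taylor D p x) x"
  using close_taylor[OF assms, of 1] assms by (simp add: p_0 smult_one)

text \<open>Such an \<open>f\<close> passes through every partial sum, and losing at most one step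
  of the filtration it passes through the limit. It will be the derivation, or the multiplication by
  the variable, of another coordinate.\<close>

lemma taylor_commute:
  assumes x: "x \<in> carrier M"
    and f_closed: "\<And>x. x \<in> carrier M \<Longrightarrow> f x \<in> carrier M"
    and f_add: "\<And>x y. x \<in> carrier M \<Longrightarrow> y \<in> carrier M \<Longrightarrow> f (x \<oplus>\<^bsub>M\<^esub> y) = f x \<oplus>\<^bsub>M\<^esub> f y"
    and f_F: "\<And>x k. x \<in> F (Suc k) \<Longrightarrow> f x \<in> F k"
    and f_p: "\<And>x k. x \<in> carrier M \<Longrightarrow> f (p k \<odot>\<^bsub>M\<^esub> x) = p k \<odot>\<^bsub>M\<^esub> f x"
    and f_D: "\<And>x. x \<in> carrier M \<Longrightarrow> f (D x) = D (f x)"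
  shows "taylor D p (f x) = f (taylor D p x)"
proof (rule taylor_eqI)
  have f_D_pow: "f ((D ^^ k) x) = (D ^^ k) (f x)" for k
    by (induction k) (simp_all add: f_D D_pow_closed x)
  have "f \<zero>\<^bsub>M\<^esub> = \<zero>\<^bsub>M\<^esub>"
    using f_add[of "\<zero>\<^bsub>M\<^esub>" "\<zero>\<^bsub>M\<^esub>"] f_closed[of "\<zero>\<^bsub>M\<^esub>"] by (simp add: M.add.l_cancel_one')
  then have f_sum: "f (taylor_sum D p k x) = taylor_sum D p k (f x)" for k
    by (induction k)
      (simp_all add: f_add f_p f_D_pow taylor_sum_closed D_pow_closed p_closed x)
  fix k
  show "close k (f (taylor D p x)) (taylor_sum D p (Suc k) (f x))"
    unfolding f_sum[symmetric]
    by (intro close_additive[of f] f_closed f_add f_F close_taylor x)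
qed (use x f_closed in simp)

end

text \<open>\<open>F_1\<close> speaks of the additive group generated by the t_j x, since the
  projection will be used as an additive map that kills t_j x for each \<open>x\<close>. The
  conditions on distinct indices make the coordinates independent of each other.\<close>

locale module_coordinates = complete_filtered_module R M F
  for R (structure) and M (structure) and F +
  fixes n :: nat
    and \<delta> :: "nat \<Rightarrow> 'a \<Rightarrow> 'a" and D :: "nat \<Rightarrow> 'c \<Rightarrow> 'c"
    and t :: "nat \<Rightarrow> 'a" and p :: "nat \<Rightarrow> nat \<Rightarrow> 'a"
  assumes coordinate:
      "j \<in> {1..n} \<Longrightarrow> module_coordinate R M F (\<delta> j) (D j) (t j) (p j)"
    and D_commute: "x \<in> carrier M \<Longrightarrow> D i (D j x) = D j (D i x)"
    and \<delta>_t_zero: "i \<in> {1..n} \<Longrightarrow> j \<in> {1..n} \<Longrightarrow> i \<noteq> j \<Longrightarrow> \<delta> i (t j) = \<zero>"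
    and \<delta>_p_zero: "i \<in> {1..n} \<Longrightarrow> j \<in> {1..n} \<Longrightarrow> i \<noteq> j \<Longrightarrow> \<delta> i (p j k) = \<zero>"
    and F_1: "F 1 \<subseteq> generate (add_monoid M) {t j \<odot>\<^bsub>M\<^esub> x | j x. j \<in> {1..n} \<and> x \<in> carrier M}"
begin

primrec partial_projection :: "nat \<Rightarrow> 'c \<Rightarrow> 'c" where
  "partial_projection 0 x = x"
| "partial_projection (Suc k) x = taylor (D (Suc k)) (p (Suc k)) (partial_projection k x)"

abbreviation projection :: "'c \<Rightarrow> 'c" where
  "projection \<equiv> partial_projection n"

section \<open>The composed projection for all variables\<close>

lemma partial_projection_closed:
  "k \<le> n \<Longrightarrow> x \<in> carrier M \<Longrightarrow> partial_projection k x \<in> carrier M"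
  by (induction k) (auto intro: module_coordinate.taylor_closed[OF coordinate])

lemma partial_projection_add:
  "k \<le> n \<Longrightarrow> x \<in> carrier M \<Longrightarrow> y \<in> carrier M \<Longrightarrow>
    partial_projection k (x \<oplus>\<^bsub>M\<^esub> y) = partial_projection k x \<oplus>\<^bsub>M\<^esub> partial_projection k y"
proof (induction k)
  case (Suc k)
  then show ?case
    using module_coordinate.taylor_add[OF coordinate, of "Suc k"]
    by (simp add: partial_projection_closed)
qed simp

text \<open>By \<open>\<delta>_p_zero\<close> the coefficients \<open>p i k\<close> are constants
  for the derivation \<open>D j\<close>, so the Leibniz rule lets \<open>D j\<close> pass
  them.\<close>

lemma taylor_D_commute:
  assumes "i \<in> {1..n}" "j \<in> {1..n}" "i \<noteq> j" "x \<in> carrier M"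
  shows "taylor (D i) (p i) (D j x) = D j (taylor (D i) (p i) x)"
proof -
  interpret i: module_coordinate R M F "\<delta> i" "D i" "t i" "p i"
    by (rule coordinate) fact
  interpret j: module_coordinate R M F "\<delta> j" "D j" "t j" "p j"
    by (rule coordinate) fact
  show ?thesis
  proof (rule i.taylor_commute[where f = "D j"])
    show "D j (p i k \<odot>\<^bsub>M\<^esub> x) = p i k \<odot>\<^bsub>M\<^esub> D j x" if "x \<in> carrier M" for x k
      using that assms by (simp add: j.D_smult j.D_closed i.p_closed \<delta>_p_zero)
  qed (use assms in \<open>auto intro: j.D_closed j.D_add j.D_F D_commute\<close>)
qed

lemma taylor_t_commute:
  assumes "i \<in> {1..n}" "j \<in> {1..n}" "i \<noteq> j" "x \<in> carrier M"
  shows "taylor (D i) (p i) (t j \<odot>\<^bsub>M\<^esub> x) = t j \<odot>\<^bsub>M\<^esub> taylor (D i) (p i) x"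
proof -
  interpret i: module_coordinate R M F "\<delta> i" "D i" "t i" "p i"
    by (rule coordinate) fact
  interpret j: module_coordinate R M F "\<delta> j" "D j" "t j" "p j"
    by (rule coordinate) fact
  have "t j \<odot>\<^bsub>M\<^esub> x \<in> F k" if "x \<in> F (Suc k)" for x k
    using that F_decreasing submoduleE(4)[OF F_submodule] j.t_closed by blast
  moreover have "t j \<odot>\<^bsub>M\<^esub> (p i k \<odot>\<^bsub>M\<^esub> x) = p i k \<odot>\<^bsub>M\<^esub> (t j \<odot>\<^bsub>M\<^esub> x)" if "x \<in> carrier M" for x k
    using that by (simp add: smult_assoc1[symmetric] R.m_comm j.t_closed i.p_closed)
  ultimately show ?thesis
    using assms
    by (intro i.taylor_commute[where f = "\<lambda>x. t j \<odot>\<^bsub>M\<^esub> x"])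
      (auto simp: smult_r_distr i.D_smult i.D_closed j.t_closed \<delta>_t_zero)
qed

lemma partial_projection_t_commute:
  assumes "j \<in> {1..n}" "x \<in> carrier M"
  shows "k < j \<Longrightarrow> partial_projection k (t j \<odot>\<^bsub>M\<^esub> x) = t j \<odot>\<^bsub>M\<^esub> partial_projection k x"
  using assms by (induction k) (auto simp: taylor_t_commute partial_projection_closed)

text \<open>The factor \<open>t j\<close> passes through the stages before \<open>j\<close> and is
  annihilated at stage \<open>j\<close>; later stages send zero to zero.\<close>

lemma partial_projection_t:
  assumes "j \<in> {1..n}" "x \<in> carrier M"
  shows "j \<le> k \<Longrightarrow> k \<le> n \<Longrightarrow> partial_projection k (t j \<odot>\<^bsub>M\<^esub> x) = \<zero>\<^bsub>M\<^esub>"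
proof (induction k)
  case (Suc k)
  interpret k: module_coordinate R M F "\<delta> (Suc k)" "D (Suc k)" "t (Suc k)" "p (Suc k)"
    using Suc by (intro coordinate) auto
  show ?case
  proof (cases "j = Suc k")
    case True
    with assms Suc show ?thesis
      by (simp add: partial_projection_t_commute k.taylor_t partial_projection_closed)
  next
    case False
    with Suc show ?thesis
      by (simp add: k.taylor_horizontal k.D_zero)
  qed
qed (use assms in simp)

text \<open>Stage \<open>j\<close> produces an element killed by \<open>D j\<close>. Later stages
  commute with \<open>D j\<close>, so they do not destroy this property.\<close>

lemma D_partial_projection:
  assumes "j \<in> {1..n}" "x \<in> carrier M"
  shows "j \<le> k \<Longrightarrow> k \<le> n \<Longrightarrow> D j (partial_projection k x) = \<zero>\<^bsub>M\<^esub>"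
proof (induction k)
  case (Suc k)
  interpret k: module_coordinate R M F "\<delta> (Suc k)" "D (Suc k)" "t (Suc k)" "p (Suc k)"
    using Suc by (intro coordinate) auto
  show ?case
  proof (cases "j = Suc k")
    case True
    with assms Suc show ?thesis
      by (simp add: k.D_taylor partial_projection_closed)
  next
    case False
    with assms Suc have "D j (partial_projection (Suc k) x) =
        taylor (D (Suc k)) (p (Suc k)) (D j (partial_projection k x))"
      using taylor_D_commute[of "Suc k" j "partial_projection k x"]
      by (simp add: partial_projection_closed)
    also have "\<dots> = \<zero>\<^bsub>M\<^esub>"
      using False Suc by (simp add: k.taylor_horizontal k.D_zero)
    finally show ?thesis .
  qed
qed (use assms in simp)

lemma partial_projection_horizontal:
  assumes "x \<in> carrier M" "\<And>j. j \<in> {1..n} \<Longrightarrow> D j x = \<zero>\<^bsub>M\<^esub>"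
  shows "k \<le> n \<Longrightarrow> partial_projection k x = x"
  using assms by (induction k) (auto simp: module_coordinate.taylor_horizontal[OF coordinate])

lemma close_partial_projection:
  assumes "x \<in> carrier M"
  shows "k \<le> n \<Longrightarrow> close 1 (partial_projection k x) x"
proof (induction k)
  case (Suc k)
  then have "close 1 (partial_projection (Suc k) x) (partial_projection k x)"
    using assms module_coordinate.close_taylor_self[OF coordinate, of "Suc k"]
    by (simp add: partial_projection_closed)
  with Suc show ?case
    using close_trans by simp
qed (use assms close_refl in simp)

lemma projection_minus:
  assumes "x \<in> carrier M"
  shows "projection (\<ominus>\<^bsub>M\<^esub> x) = \<ominus>\<^bsub>M\<^esub> projection x"
proof -
  have "projection x \<oplus>\<^bsub>M\<^esub> projection (\<ominus>\<^bsub>M\<^esub> x) = projection \<zero>\<^bsub>M\<^esub>"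
    using assms by (simp add: partial_projection_add[symmetric] M.r_neg)
  moreover have "projection \<zero>\<^bsub>M\<^esub> = \<zero>\<^bsub>M\<^esub>"
    using partial_projection_add[of n "\<zero>\<^bsub>M\<^esub>" "\<zero>\<^bsub>M\<^esub>"] partial_projection_closed[of n "\<zero>\<^bsub>M\<^esub>"]
    by (simp add: M.add.l_cancel_one')
  ultimately show ?thesis
    using assms M.minus_equality[of "projection (\<ominus>\<^bsub>M\<^esub> x)" "projection x"]
    by (simp add: partial_projection_closed M.a_comm)
qed

lemma projection_F_1:
  assumes "x \<in> F 1"
  shows "projection x = \<zero>\<^bsub>M\<^esub>"
proof -
  \<comment> \<open>Membership in the carrier is carried through the induction because additivity of
    the projection is available on the carrier.\<close>
  have "x \<in> carrier M \<and> projection x = \<zero>\<^bsub>M\<^esub>"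
    if "x \<in> generate (add_monoid M) {t j \<odot>\<^bsub>M\<^esub> x | j x. j \<in> {1..n} \<and> x \<in> carrier M}" for x
    using that
  proof (induction rule: generate.induct)
    case one
    show ?case
      using partial_projection_add[of n "\<zero>\<^bsub>M\<^esub>" "\<zero>\<^bsub>M\<^esub>"] partial_projection_closed[of n "\<zero>\<^bsub>M\<^esub>"]
      by (simp add: M.add.l_cancel_one')
  next
    case (incl h)
    then show ?case
      using module_coordinate.t_closed[OF coordinate] partial_projection_t by auto
  next
    case (inv h)
    then have "h \<in> carrier M \<and> projection h = \<zero>\<^bsub>M\<^esub>"
      using module_coordinate.t_closed[OF coordinate] partial_projection_t by auto
    then show ?case
      by (simp add: a_inv_def[symmetric] projection_minus)
  next
    case (eng h1 h2)
    then show ?case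
      by (simp add: partial_projection_add)
  qed
  with assms F_1 show ?thesis
    by blast
qed

theorem bij_betw_horizontal:
  "bij_betw (\<lambda>m. F 1 +>\<^bsub>M\<^esub> m) {m \<in> carrier M. \<forall>j\<in>{1..n}. D j m = \<zero>\<^bsub>M\<^esub>} (a_rcosets\<^bsub>M\<^esub> F 1)"
proof -
  have subgroup: "subgroup (F 1) (add_monoid M)"
    using F_submodule submodule.axioms(1) by blast
  have coset_eq_iff: "F 1 +>\<^bsub>M\<^esub> x = F 1 +>\<^bsub>M\<^esub> y \<longleftrightarrow> x \<ominus>\<^bsub>M\<^esub> y \<in> F 1"
    if "x \<in> carrier M" "y \<in> carrier M" for x y
    using that by (rule M.coset_eq_iff_minus[OF subgroup])
  show ?thesis
  proof (rule bij_betw_imageI)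
    show "inj_on (\<lambda>m. F 1 +>\<^bsub>M\<^esub> m) {m \<in> carrier M. \<forall>j\<in>{1..n}. D j m = \<zero>\<^bsub>M\<^esub>}"
    proof (rule inj_onI, clarify)
      fix x y
      assume x: "x \<in> carrier M" "\<forall>j\<in>{1..n}. D j x = \<zero>\<^bsub>M\<^esub>"
        and y: "y \<in> carrier M" "\<forall>j\<in>{1..n}. D j y = \<zero>\<^bsub>M\<^esub>"
        and eq: "F 1 +>\<^bsub>M\<^esub> x = F 1 +>\<^bsub>M\<^esub> y"
      \<comment> \<open>The difference is killed as an element of \<open>F 1\<close> and fixed as a
        difference of horizontal elements, so it is zero.\<close>
      have "projection (x \<ominus>\<^bsub>M\<^esub> y) = \<zero>\<^bsub>M\<^esub>"
        using x y eq coset_eq_iff projection_F_1 by simp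
      moreover have "projection x = x" "projection y = y"
        using x y by (auto intro: partial_projection_horizontal)
      then have "projection (x \<ominus>\<^bsub>M\<^esub> y) = x \<ominus>\<^bsub>M\<^esub> y"
        using x y by (simp add: M.minus_eq partial_projection_add projection_minus)
      ultimately show "x = y"
        using x y by (simp add: M.minus_eq_zero_iff)
    qed
    show "(\<lambda>m. F 1 +>\<^bsub>M\<^esub> m) ` {m \<in> carrier M. \<forall>j\<in>{1..n}. D j m = \<zero>\<^bsub>M\<^esub>} = a_rcosets\<^bsub>M\<^esub> F 1"
    proof (intro equalityI subsetI)
      fix C
      assume "C \<in> a_rcosets\<^bsub>M\<^esub> F 1"
      then obtain x where x: "x \<in> carrier M" "C = F 1 +>\<^bsub>M\<^esub> x"
        by (auto simp: A_RCOSETS_def')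
      have "C = F 1 +>\<^bsub>M\<^esub> projection x"
        using close_sym[OF close_partial_projection[OF x(1) order_refl]] x(2) coset_eq_iff
        by (auto simp: close_def)
      then show "C \<in> (\<lambda>m. F 1 +>\<^bsub>M\<^esub> m) ` {m \<in> carrier M. \<forall>j\<in>{1..n}. D j m = \<zero>\<^bsub>M\<^esub>}"
        using x(1) D_partial_projection partial_projection_closed by auto
    qed (auto simp: A_RCOSETS_def')
  qed
qed

end

section \<open>Adic filtrations\<close>

lemma (in cring) ideal_power_ideal: "ideal I R \<Longrightarrow> ideal (I [^]\<^bsub>ideals_set R\<^esub> (k::nat)) R"
  using monoid.nat_pow_closed[OF comm_monoid.axioms(1)[OF ideals_set_is_comm_monoid], of I k]
  by (simp add: ideals_set_def)

lemma ideal_power_0: "I [^]\<^bsub>ideals_set R\<^esub> (0::nat) = carrier R"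
  by (simp add: ideals_set_def)

lemma ideal_power_Suc:
  "I [^]\<^bsub>ideals_set R\<^esub> Suc k = ideal_prod R (I [^]\<^bsub>ideals_set R\<^esub> k) I"
  by (simp add: ideals_set_def nat_pow_def)

lemma (in cring) ideal_power_1: "ideal I R \<Longrightarrow> I [^]\<^bsub>ideals_set R\<^esub> (1::nat) = I"
  using monoid.nat_pow_eone[OF comm_monoid.axioms(1)[OF ideals_set_is_comm_monoid], of I]
  by (simp add: ideals_set_def)

text \<open>Since I^(k+2) = I^(k+1) I, a generator i j has derivative d(i) j + i d(j). The first
  term lies in I^k I by the outer induction, the second in I^(k+1) already. For k = 0 the target is
  the whole ring.\<close>

lemma (in cring) derivation_ideal_power:
  assumes I: "ideal I R"
    and closed: "\<And>r. r \<in> carrier R \<Longrightarrow> \<delta> r \<in> carrier R"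
    and add: "\<And>r s. r \<in> carrier R \<Longrightarrow> s \<in> carrier R \<Longrightarrow> \<delta> (r \<oplus> s) = \<delta> r \<oplus> \<delta> s"
    and mult: "\<And>r s. r \<in> carrier R \<Longrightarrow> s \<in> carrier R \<Longrightarrow> \<delta> (r \<otimes> s) = \<delta> r \<otimes> s \<oplus> r \<otimes> \<delta> s"
  shows "r \<in> I [^]\<^bsub>ideals_set R\<^esub> Suc k \<Longrightarrow> \<delta> r \<in> I [^]\<^bsub>ideals_set R\<^esub> k"
proof (induction k arbitrary: r)
  case 0
  then show ?case
    using ideal.Icarr[OF ideal_power_ideal[OF I]] closed by (metis ideal_power_0)
next
  case (Suc k)
  have ideal: "ideal (I [^]\<^bsub>ideals_set R\<^esub> i) R" for i :: nat
    by (rule ideal_power_ideal[OF I])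
  have "r \<in> ideal_prod R (I [^]\<^bsub>ideals_set R\<^esub> Suc k) I"
    using Suc.prems by (simp only: ideal_power_Suc)
  then show ?case
  proof (induction r rule: ideal_prod.induct)
    case (prod i j)
    then have carrier: "i \<in> carrier R" "j \<in> carrier R"
      using ideal.Icarr[OF ideal] ideal.Icarr[OF I] by blast+
    have "\<delta> i \<otimes> j \<in> I [^]\<^bsub>ideals_set R\<^esub> Suc k"
      unfolding ideal_power_Suc using prod Suc.IH by (intro ideal_prod.prod)
    moreover have "i \<otimes> \<delta> j \<in> I [^]\<^bsub>ideals_set R\<^esub> Suc k"
      using prod carrier closed by (intro ideal.I_r_closed[OF ideal])
    ultimately show ?case
      unfolding mult[OF carrier] by (rule additive_subgroup.a_closed[OF ideal.axioms(1)[OF ideal]])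
  next
    case (sum r s)
    then have carrier: "r \<in> carrier R" "s \<in> carrier R"
      using ideal_prod_in_carrier[OF ideal I] by blast+
    from sum show ?case
      unfolding add[OF carrier] by (intro additive_subgroup.a_closed[OF ideal.axioms(1)[OF ideal]])
  qed
qed

context module
begin

section \<open>Submodules generated by ideals, and completeness\<close>

lemma ideal_smult_generators_carrier:
  "ideal I R \<Longrightarrow> {r \<odot>\<^bsub>M\<^esub> x | r x. r \<in> I \<and> x \<in> carrier M} \<subseteq> carrier M"
  using ideal.Icarr by fastforce

lemma ideal_smult_subgroup:
  assumes "ideal I R"
  shows "subgroup (ideal_smult I M) (add_monoid M)"
  unfolding ideal_smult_def
  using ideal_smult_generators_carrier[OF assms]
  by (intro group.generate_is_subgroup) (auto simp: M.a_group)

lemma ideal_smultI: "r \<in> I \<Longrightarrow> x \<in> carrier M \<Longrightarrow> r \<odot>\<^bsub>M\<^esub> x \<in> ideal_smult I M"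
  unfolding ideal_smult_def by (rule generate.incl) blast

text \<open>The case of inverses disappears: the negative of a generator r x is the generator (-r)
  x, as an ideal is closed under negation.\<close>

lemma ideal_smult_induct [consumes 2, case_names zero smult add]:
  assumes I: "ideal I R" and y: "y \<in> ideal_smult I M"
    and "P \<zero>\<^bsub>M\<^esub>"
    and smult: "\<And>r x. r \<in> I \<Longrightarrow> x \<in> carrier M \<Longrightarrow> P (r \<odot>\<^bsub>M\<^esub> x)"
    and add: "\<And>x y. x \<in> carrier M \<Longrightarrow> y \<in> carrier M \<Longrightarrow> P x \<Longrightarrow> P y \<Longrightarrow> P (x \<oplus>\<^bsub>M\<^esub> y)"
  shows "P y"
proof -
  have "y \<in> carrier M \<and> P y"
    using y unfolding ideal_smult_def
  proof (induction rule: generate.induct)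
    case one
    then show ?case
      using \<open>P \<zero>\<^bsub>M\<^esub>\<close> by simp
  next
    case (incl h)
    then show ?case
      using smult ideal.Icarr[OF I] by auto
  next
    case (inv h)
    then obtain r x where h: "h = r \<odot>\<^bsub>M\<^esub> x" "r \<in> I" "x \<in> carrier M"
      by blast
    moreover from h have "\<ominus>\<^bsub>M\<^esub> h = (\<ominus> r) \<odot>\<^bsub>M\<^esub> x"
      using ideal.Icarr[OF I] by (simp add: smult_l_minus)
    moreover have "\<ominus> r \<in> I"
      using additive_subgroup.a_inv_closed[OF ideal.axioms(1)[OF I]] h by blast
    ultimately show ?case
      using smult ideal.Icarr[OF I] by (auto simp: a_inv_def[symmetric])
  next
    case (eng x y)
    then show ?case
      using add by simp
  qed
  then show ?thesis ..
qed

lemma ideal_smult_submodule: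
  assumes I: "ideal I R"
  shows "submodule (ideal_smult I M) R M"
proof (intro submodule.intro submodule_axioms.intro ideal_smult_subgroup I)
  fix a y
  assume a: "a \<in> carrier R" and "y \<in> ideal_smult I M"
  from I this(2) show "a \<odot>\<^bsub>M\<^esub> y \<in> ideal_smult I M"
  proof (induction rule: ideal_smult_induct)
    case zero
    then show ?case
      using a subgroup.one_closed[OF ideal_smult_subgroup[OF I]] by simp
  next
    case (smult r x)
    then show ?case
      using a ideal_smultI[OF ideal.I_l_closed[OF I, of r a]] ideal.Icarr[OF I]
      by (simp add: smult_assoc1[symmetric])
  next
    case (add x y)
    then show ?case
      using a subgroup.m_closed[OF ideal_smult_subgroup[OF I]] by (simp add: smult_r_distr)
  qed
qed

lemma ideal_smult_mono: "I \<subseteq> J \<Longrightarrow> ideal_smult I M \<subseteq> ideal_smult J M"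
  unfolding ideal_smult_def by (intro group.mono_generate[OF M.a_group]) blast

text \<open>The ring elements that send all of the module into the group on the right form an ideal:
  (a r) x = r (a x), and a x is again in the module. This ideal contains \<open>S\<close>, hence the
  ideal generated by \<open>S\<close>.\<close>

lemma ideal_smult_genideal_subset:
  assumes S: "S \<subseteq> carrier R"
  shows "ideal_smult (genideal R S) M \<subseteq>
    generate (add_monoid M) {s \<odot>\<^bsub>M\<^esub> x | s x. s \<in> S \<and> x \<in> carrier M}" (is "_ \<subseteq> ?G")
proof -
  have gens: "{s \<odot>\<^bsub>M\<^esub> x | s x. s \<in> S \<and> x \<in> carrier M} \<subseteq> carrier (add_monoid M)"
    using S by auto
  have G: "subgroup ?G (add_monoid M)"
    by (rule group.generate_is_subgroup[OF M.a_group gens])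
  note G_zero = subgroup.one_closed[OF G, simplified]
    and G_add = subgroup.m_closed[OF G, simplified]
    and G_minus = subgroup.m_inv_closed[OF G, folded a_inv_def]
  let ?J = "{r \<in> carrier R. \<forall>x\<in>carrier M. r \<odot>\<^bsub>M\<^esub> x \<in> ?G}"
  have "ideal ?J R"
  proof (rule idealI)
    show "subgroup ?J (add_monoid R)"
    proof (rule R.add.subgroupI)
      show "?J \<noteq> {}"
        using G_zero by (auto intro!: exI[of _ \<zero>])
    qed (auto simp: smult_l_minus smult_l_distr G_minus G_add)
  qed (auto simp: R.ring_axioms smult_assoc1 R.m_comm)
  moreover have "S \<subseteq> ?J"
    using S by (auto intro: generate.incl)
  ultimately have "genideal R S \<subseteq> ?J"
    by (rule R.genideal_minimal)
  then show ?thesis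
    unfolding ideal_smult_def
    by (intro group.generate_subgroup_incl[OF M.a_group _ G]) auto
qed

text \<open>In D (r x) = r (D x) + d(r) x with \<open>r\<close> in I^(k+1), both \<open>r\<close>
  and d(r) lie in I^k, the latter by \<open>derivation_ideal_power\<close>.\<close>

lemma derivation_adic_submodule:
  assumes I: "ideal I R"
    and closed: "\<And>r. r \<in> carrier R \<Longrightarrow> \<delta> r \<in> carrier R"
    and add: "\<And>r s. r \<in> carrier R \<Longrightarrow> s \<in> carrier R \<Longrightarrow> \<delta> (r \<oplus> s) = \<delta> r \<oplus> \<delta> s"
    and mult: "\<And>r s. r \<in> carrier R \<Longrightarrow> s \<in> carrier R \<Longrightarrow> \<delta> (r \<otimes> s) = \<delta> r \<otimes> s \<oplus> r \<otimes> \<delta> s"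
    and D_closed: "\<And>x. x \<in> carrier M \<Longrightarrow> D x \<in> carrier M"
    and D_add: "\<And>x y. x \<in> carrier M \<Longrightarrow> y \<in> carrier M \<Longrightarrow> D (x \<oplus>\<^bsub>M\<^esub> y) = D x \<oplus>\<^bsub>M\<^esub> D y"
    and D_smult: "\<And>r x. r \<in> carrier R \<Longrightarrow> x \<in> carrier M \<Longrightarrow>
      D (r \<odot>\<^bsub>M\<^esub> x) = r \<odot>\<^bsub>M\<^esub> D x \<oplus>\<^bsub>M\<^esub> \<delta> r \<odot>\<^bsub>M\<^esub> x"
    and y: "y \<in> adic_submodule R I M (Suc k)"
  shows "D y \<in> adic_submodule R I M k"
proof -
  have ideal: "ideal (I [^]\<^bsub>ideals_set R\<^esub> i) R" for i :: nat
    by (rule ideal_power_ideal[OF I])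
  note F_add = submoduleE(5)[OF ideal_smult_submodule[OF ideal]]
  from ideal y show ?thesis
    unfolding adic_submodule_def
  proof (induction rule: ideal_smult_induct)
    case zero
    have "D \<zero>\<^bsub>M\<^esub> = \<zero>\<^bsub>M\<^esub>"
      using D_add[of "\<zero>\<^bsub>M\<^esub>" "\<zero>\<^bsub>M\<^esub>"] D_closed[of "\<zero>\<^bsub>M\<^esub>"] by (simp add: M.add.l_cancel_one')
    then show ?case
      using subgroup.one_closed[OF ideal_smult_subgroup[OF ideal]] by simp
  next
    case (smult r x)
    have "r \<in> I [^]\<^bsub>ideals_set R\<^esub> k"
      using smult(1) ideal_prod_inter[OF ideal I] unfolding ideal_power_Suc by blast
    moreover have "\<delta> r \<in> I [^]\<^bsub>ideals_set R\<^esub> k"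
      using derivation_ideal_power[OF I closed add mult smult(1)] .
    moreover have "r \<in> carrier R"
      using smult(1) ideal.Icarr[OF ideal] by blast
    ultimately show ?case
      using smult(2) by (simp add: D_smult D_closed F_add ideal_smultI)
  next
    case (add x y)
    then show ?case
      by (simp add: D_add F_add)
  qed
qed

text \<open>Injectivity of the map to the inverse limit gives separatedness. For surjectivity, a
  sequence whose increments lie in the filtration defines a compatible family of cosets, and a
  preimage of this family is the limit.\<close>

lemma adically_complete_imp_complete_filtered:
  assumes I: "ideal I R" and complete: "adically_complete R I M"
  shows "complete_filtered_module R M (adic_submodule R I M)"
proof -
  let ?F = "adic_submodule R I M"
  have ideal: "ideal (I [^]\<^bsub>ideals_set R\<^esub> i) R" for i :: nat
    by (rule ideal_power_ideal[OF I])
  have submodule: "submodule (?F k) R M" for k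
    unfolding adic_submodule_def by (rule ideal_smult_submodule[OF ideal])
  then have subgroup: "subgroup (?F k) (add_monoid M)" for k
    using submodule.axioms(1) by blast
  have subset: "?F k \<subseteq> carrier M" for k
    by (rule submoduleE(1)[OF submodule])
  have decreasing: "?F (Suc k) \<subseteq> ?F k" for k
    unfolding adic_submodule_def ideal_power_Suc
    using ideal_prod_inter[OF ideal I] by (intro ideal_smult_mono) blast
  have bij: "bij_betw (\<lambda>x i. ?F i +>\<^bsub>M\<^esub> x) (carrier M) (carrier (adic_completion R I M))"
    using complete by (simp add: adically_complete_def module_iso_def)
  show ?thesis
  proof (intro complete_filtered_module.intro complete_filtered_module_axioms.intro
      submodule decreasing module_axioms)
    fix x
    assume x: "x \<in> carrier M" "\<And>k. x \<in> ?F k"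
    have "(\<lambda>i. ?F i +>\<^bsub>M\<^esub> x) = (\<lambda>i. ?F i +>\<^bsub>M\<^esub> \<zero>\<^bsub>M\<^esub>)"
      using x M.a_coset_join2[OF _ subgroup] subset by simp
    with bij x(1) show "x = \<zero>\<^bsub>M\<^esub>"
      by (auto simp: bij_betw_def dest: inj_onD)
  next
    fix xs
    assume xs: "\<And>k. xs k \<in> carrier M" "\<And>k. xs (Suc k) \<ominus>\<^bsub>M\<^esub> xs k \<in> ?F k"
    have coset_eq_iff: "?F k +>\<^bsub>M\<^esub> x = ?F k +>\<^bsub>M\<^esub> y \<longleftrightarrow> x \<ominus>\<^bsub>M\<^esub> y \<in> ?F k"
      if "x \<in> carrier M" "y \<in> carrier M" for x y k
      using that by (rule M.coset_eq_iff_minus[OF subgroup])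
    have "(\<lambda>i. ?F i +>\<^bsub>M\<^esub> xs i) \<in> carrier (adic_completion R I M)"
    proof -
      \<comment> \<open>Compatibility: the transition map enlarges the coset to one modulo
        \<open>?F i\<close>, which absorbs both \<open>?F (Suc i)\<close> and the increment.\<close>
      have "?F i <+>\<^bsub>M\<^esub> (?F (Suc i) +>\<^bsub>M\<^esub> xs (Suc i)) = ?F i +>\<^bsub>M\<^esub> xs i" for i
      proof -
        have "?F i <+>\<^bsub>M\<^esub> ?F (Suc i) = ?F i"
        proof
          show "?F i <+>\<^bsub>M\<^esub> ?F (Suc i) \<subseteq> ?F i"
            using decreasing[of i] submoduleE(5)[OF submodule, of _ i] unfolding set_add_def' by blast
          show "?F i \<subseteq> ?F i <+>\<^bsub>M\<^esub> ?F (Suc i)"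
          proof
            fix x
            assume "x \<in> ?F i"
            moreover have "\<zero>\<^bsub>M\<^esub> \<in> ?F (Suc i)"
              using subgroup.one_closed[OF subgroup] by simp
            ultimately show "x \<in> ?F i <+>\<^bsub>M\<^esub> ?F (Suc i)"
              using subset by (force simp: set_add_def')
          qed
        qed
        then have "?F i <+>\<^bsub>M\<^esub> (?F (Suc i) +>\<^bsub>M\<^esub> xs (Suc i)) = ?F i +>\<^bsub>M\<^esub> xs (Suc i)"
          using M.a_setmult_rcos_assoc[OF subset subset xs(1)] by simp
        also have "\<dots> = ?F i +>\<^bsub>M\<^esub> xs i"
          using xs coset_eq_iff by simp
        finally show ?thesis .
      qed
      then show ?thesis
        using M.a_rcosetsI[OF subset xs(1)]
        by (simp add: adic_completion_def inverse_limit_module_def quotient_module_def)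
    qed
    then obtain x where x: "x \<in> carrier M" "(\<lambda>i. ?F i +>\<^bsub>M\<^esub> xs i) = (\<lambda>i. ?F i +>\<^bsub>M\<^esub> x)"
      using bij by (auto simp: bij_betw_def)
    from x(2) have "?F i +>\<^bsub>M\<^esub> x = ?F i +>\<^bsub>M\<^esub> xs i" for i
      by metis
    with x(1) xs(1) show "\<exists>x\<in>carrier M. \<forall>k. x \<ominus>\<^bsub>M\<^esub> xs k \<in> ?F k"
      using coset_eq_iff by blast
  qed
qed

end

section \<open>Modules over the differential operators\<close>

lemma endomorphism_ring_simps:
  "\<theta> \<in> carrier (endomorphism_ring A B) \<longleftrightarrow> \<theta> \<in> carrier B \<rightarrow>\<^sub>E carrier B \<and>
    (\<forall>x\<in>carrier B. \<forall>y\<in>carrier B. \<theta> (x \<oplus>\<^bsub>B\<^esub> y) = \<theta> x \<oplus>\<^bsub>B\<^esub> \<theta> y) \<and>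
    (\<forall>a\<in>carrier A. \<forall>x\<in>carrier B. \<theta> (a \<odot>\<^bsub>B\<^esub> x) = a \<odot>\<^bsub>B\<^esub> \<theta> x)"
  by (simp add: endomorphism_ring_def)

lemma diff_operator_ring_simps:
  "carrier (diff_operator_ring A B) = (\<Union>k. diff_operators_le A B k)"
  "\<theta> \<otimes>\<^bsub>diff_operator_ring A B\<^esub> \<phi> = compose (carrier B) \<theta> \<phi>"
  "\<one>\<^bsub>diff_operator_ring A B\<^esub> = (\<lambda>x\<in>carrier B. x)"
  "\<theta> \<oplus>\<^bsub>diff_operator_ring A B\<^esub> \<phi> = (\<lambda>x\<in>carrier B. \<theta> x \<oplus>\<^bsub>B\<^esub> \<phi> x)"
  by (simp_all add: diff_operator_ring_def endomorphism_ring_def)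

context cring
begin

section \<open>Multiplications and partial derivatives as differential operators\<close>

lemma mult_operator_diff_operators_le:
  assumes b: "b \<in> carrier (power_series R n)"
  shows "mult_operator (power_series R n) b \<in> diff_operators_le R (power_series R n) 0"
proof -
  interpret B: cring "power_series R n"
    by (rule power_series_cring)
  show ?thesis
    using b
    by (auto simp: endomorphism_ring_simps mult_operator_def B.r_distr B.m_lcomm
        power_series_smult_eq_mult monomial_series_closed)
qed

lemma mult_operator_closed:
  "b \<in> carrier (power_series R n) \<Longrightarrow>
    mult_operator (power_series R n) b \<in> carrier (power_series_diff_ops R n)"
  unfolding diff_operator_ring_simps(1) using mult_operator_diff_operators_le by blast

text \<open>Linearity over the base is the Leibniz rule for a constant factor, whose derivative is
  zero. The value \<open>undefined\<close> off the carrier gives extensionality.\<close>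

lemma partial_derivative_endomorphism:
  "partial_derivative R n j \<in> carrier (endomorphism_ring R (power_series R n))"
proof -
  interpret B: cring "power_series R n"
    by (rule power_series_cring)
  have "partial_derivative R n j (a \<odot>\<^bsub>power_series R n\<^esub> f) =
      a \<odot>\<^bsub>power_series R n\<^esub> partial_derivative R n j f"
    if "a \<in> carrier R" "f \<in> carrier (power_series R n)" for a f
    using that
    by (simp add: power_series_smult_eq_mult monomial_series_closed partial_derivative_closed
        partial_derivative_mult partial_derivative_monomial_zero)
  moreover have "partial_derivative R n j f = undefined" if "f \<notin> carrier (power_series R n)" for f
    using that by (simp add: partial_derivative_def)
  ultimately show ?thesis
    by (auto simp: endomorphism_ring_simps partial_derivative_closed partial_derivative_add)
qed

text \<open>The Leibniz rule rearranged. As multiplication operators have order at most 0, it shows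
  that a partial derivative has order at most 1.\<close>

lemma operator_commutator_partial_derivative:
  assumes b: "b \<in> carrier (power_series R n)"
  shows "operator_commutator (power_series R n) b (partial_derivative R n j) =
    mult_operator (power_series R n) (\<ominus>\<^bsub>power_series R n\<^esub> partial_derivative R n j b)"
proof -
  interpret B: cring "power_series R n"
    by (rule power_series_cring)
  have "b \<otimes>\<^bsub>power_series R n\<^esub> x' \<ominus>\<^bsub>power_series R n\<^esub>
      (b' \<otimes>\<^bsub>power_series R n\<^esub> x \<oplus>\<^bsub>power_series R n\<^esub> b \<otimes>\<^bsub>power_series R n\<^esub> x') =
      (\<ominus>\<^bsub>power_series R n\<^esub> b') \<otimes>\<^bsub>power_series R n\<^esub> x"
    if "x \<in> carrier (power_series R n)" "x' \<in> carrier (power_series R n)"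
      "b' \<in> carrier (power_series R n)" for x x' b'
    using b that by algebra
  with b show ?thesis
    by (auto simp: operator_commutator_def mult_operator_def partial_derivative_mult
        partial_derivative_closed intro!: restrict_ext)
qed

lemma partial_derivative_in_diff_operators:
  "partial_derivative R n j \<in> carrier (power_series_diff_ops R n)"
proof -
  interpret B: cring "power_series R n"
    by (rule power_series_cring)
  have "operator_commutator (power_series R n) b (partial_derivative R n j)
      \<in> diff_operators_le R (power_series R n) 0" if "b \<in> carrier (power_series R n)" for b
    unfolding operator_commutator_partial_derivative[OF that]
    using that by (intro mult_operator_diff_operators_le B.a_inv_closed partial_derivative_closed)
  then have "partial_derivative R n j \<in> diff_operators_le R (power_series R n) (Suc 0)"
    using partial_derivative_endomorphism by (simp del: diff_operators_le.simps(1))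
  then show ?thesis
    unfolding diff_operator_ring_simps(1) by blast
qed

lemma mult_operator_add:
  assumes "b \<in> carrier (power_series R n)" "c \<in> carrier (power_series R n)"
  shows "mult_operator (power_series R n) (b \<oplus>\<^bsub>power_series R n\<^esub> c) =
    mult_operator (power_series R n) b \<oplus>\<^bsub>power_series_diff_ops R n\<^esub>
    mult_operator (power_series R n) c"
proof -
  interpret B: cring "power_series R n"
    by (rule power_series_cring)
  show ?thesis
    using assms
    by (auto simp: diff_operator_ring_simps mult_operator_def B.l_distr intro!: restrict_ext)
qed

lemma mult_operator_mult:
  assumes "b \<in> carrier (power_series R n)" "c \<in> carrier (power_series R n)"
  shows "mult_operator (power_series R n) (b \<otimes>\<^bsub>power_series R n\<^esub> c) =
    mult_operator (power_series R n) b \<otimes>\<^bsub>power_series_diff_ops R n\<^esub>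
    mult_operator (power_series R n) c"
proof -
  interpret B: cring "power_series R n"
    by (rule power_series_cring)
  show ?thesis
    using assms
    by (auto simp: diff_operator_ring_simps mult_operator_def compose_def B.m_assoc
        intro!: restrict_ext)
qed

lemma mult_operator_one:
  "mult_operator (power_series R n) \<one>\<^bsub>power_series R n\<^esub> = \<one>\<^bsub>power_series_diff_ops R n\<^esub>"
proof -
  interpret B: cring "power_series R n"
    by (rule power_series_cring)
  show ?thesis
    by (auto simp: diff_operator_ring_simps mult_operator_def intro!: restrict_ext)
qed

text \<open>The Leibniz rule as a relation inside the operator ring, the form in which it can act on
  an arbitrary module.\<close>

lemma partial_derivative_mult_operator:
  assumes "b \<in> carrier (power_series R n)"
  shows "partial_derivative R n j \<otimes>\<^bsub>power_series_diff_ops R n\<^esub>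
      mult_operator (power_series R n) b =
    mult_operator (power_series R n) b \<otimes>\<^bsub>power_series_diff_ops R n\<^esub>
      partial_derivative R n j \<oplus>\<^bsub>power_series_diff_ops R n\<^esub>
    mult_operator (power_series R n) (partial_derivative R n j b)"
proof -
  interpret B: cring "power_series R n"
    by (rule power_series_cring)
  show ?thesis
    using assms
    by (auto simp: diff_operator_ring_simps mult_operator_def compose_def partial_derivative_mult
        partial_derivative_closed B.a_comm intro!: restrict_ext)
qed

lemma partial_derivative_operators_commute:
  "partial_derivative R n i \<otimes>\<^bsub>power_series_diff_ops R n\<^esub> partial_derivative R n j =
    partial_derivative R n j \<otimes>\<^bsub>power_series_diff_ops R n\<^esub> partial_derivative R n i"
  by (auto simp: diff_operator_ring_simps compose_def intro!: restrict_ext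
      partial_derivative_commute)

section \<open>The Taylor coefficients and their adic order\<close>

lemma power_series_minus:
  assumes "f \<in> carrier (power_series R n)"
  shows "\<ominus>\<^bsub>power_series R n\<^esub> f = (\<lambda>m. \<ominus> f m)"
proof -
  interpret B: cring "power_series R n"
    by (rule power_series_cring)
  show ?thesis
    using assms by (intro B.minus_equality) (auto simp: power_series_simps l_neg)
qed

lemma monomial_series_minus:
  assumes "a \<in> carrier R" "set_mset k \<subseteq> {1..n}"
  shows "\<ominus>\<^bsub>power_series R n\<^esub> monomial_series k a = monomial_series k (\<ominus> a)"
  unfolding power_series_minus[OF monomial_series_closed[OF assms]]
  by (auto simp: monomial_series_def)

lemma monomial_series_add_pow:
  "a \<in> carrier R \<Longrightarrow>
    [(i::nat)] \<cdot>\<^bsub>power_series R n\<^esub> monomial_series k a = monomial_series k ([i] \<cdot> a)"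
proof (induction i)
  case 0
  show ?case
    by (auto simp: add_pow_def nat_pow_def power_series_simps(4) monomial_series_def)
next
  case (Suc i)
  then show ?case
    by (auto simp: add_pow_def nat_pow_def power_series_simps(5) monomial_series_def fun_eq_iff)
qed

lemma indexed_var_closed: "j \<in> {1..n} \<Longrightarrow> indexed_var j \<in> carrier (power_series R n)"
  unfolding indexed_var_eq_monomial by (rule monomial_series_closed) auto

lemma variable_ideal_ideal: "ideal (variable_ideal R n) (power_series R n)"
  unfolding variable_ideal_def
  by (intro ring.genideal_ideal cring.axioms(1) power_series_cring) (auto intro: indexed_var_closed)

text \<open>The source of convergence: the i-th Taylor coefficient is a multiple of t_j^i and so
  carries the module into the i-th step of the filtration.\<close>

lemma monomial_series_in_ideal_power:
  assumes "j \<in> {1..n}" "a \<in> carrier R"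
  shows "monomial_series (replicate_mset i j) a \<in>
    variable_ideal R n [^]\<^bsub>ideals_set (power_series R n)\<^esub> i"
proof (induction i)
  case 0
  with assms show ?case
    unfolding ideal_power_0 by (simp add: monomial_series_closed)
next
  case (Suc i)
  have "indexed_var j \<in> variable_ideal R n"
    unfolding variable_ideal_def using assms(1)
    by (intro subsetD[OF ring.genideal_self[OF cring.axioms(1)[OF power_series_cring]]])
      (auto intro: indexed_var_closed)
  with Suc have "monomial_series (replicate_mset i j) a \<otimes>\<^bsub>power_series R n\<^esub> indexed_var j \<in>
      variable_ideal R n [^]\<^bsub>ideals_set (power_series R n)\<^esub> Suc i"
    unfolding ideal_power_Suc by (rule ideal_prod.prod)
  then show ?case
    using assms by (simp add: indexed_var_eq_monomial monomial_series_mult_monomial)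
qed

text \<open>The sequence is the image of (-1)^i / i!. Only its initial value and recurrence are
  passed on: the recurrence controls both the derivative of c_i t^i and its product with
  \<open>t\<close>.\<close>

lemma contains_rationals_factorials:
  assumes "contains_rationals R"
  obtains c :: "nat \<Rightarrow> 'a" where "\<And>i. c i \<in> carrier R" "c 0 = \<one>"
    "\<And>i. [Suc i] \<cdot> c (Suc i) = \<ominus> c i"
proof -
  from assms obtain h where h: "h \<in> ring_hom (ring_of_type_algebra :: rat ring) R"
    by (auto simp: contains_rationals_def)
  have closed: "h x \<in> carrier R" for x
    using ring_hom_closed[OF h] by (simp add: ring_of_type_algebra_def)
  have add: "h (x + y) = h x \<oplus> h y" for x y
    using ring_hom_add[OF h, of x y] by (simp add: ring_of_type_algebra_def)
  have zero: "h 0 = \<zero>"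
    using add[of 0 0] closed[of 0] by (simp add: add.l_cancel_one')
  have minus: "h (- x) = \<ominus> h x" for x
    using add[of "- x" x] closed zero by (intro minus_equality[symmetric]) auto
  have add_pow: "h (of_nat k * x) = [k] \<cdot> h x" for k x
    using closed by (induction k) (auto simp: zero add distrib_right a_comm)
  define c where "c i = h ((- 1) ^ i / fact i)" for i
  have "c 0 = \<one>"
    using ring_hom_one[OF h] by (simp add: c_def ring_of_type_algebra_def)
  moreover have "[Suc i] \<cdot> c (Suc i) = \<ominus> c i" for i
  proof -
    have "[Suc i] \<cdot> c (Suc i) = h (of_nat (Suc i) * ((- 1) ^ Suc i / fact (Suc i)))"
      unfolding c_def add_pow ..
    also have "of_nat (Suc i) * ((- 1) ^ Suc i / fact (Suc i)) = - ((- 1) ^ i / fact i :: rat)"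
      by (simp add: field_simps del: of_nat_Suc)
    finally show ?thesis
      by (simp add: c_def minus)
  qed
  ultimately show ?thesis
    using that[of c] closed by (auto simp: c_def)
qed

end

lemma underlying_module_simps:
  "carrier (underlying_module A n M) = carrier M"
  "\<zero>\<^bsub>underlying_module A n M\<^esub> = \<zero>\<^bsub>M\<^esub>"
  "x \<oplus>\<^bsub>underlying_module A n M\<^esub> y = x \<oplus>\<^bsub>M\<^esub> y"
  "b \<odot>\<^bsub>underlying_module A n M\<^esub> x = mult_operator (power_series A n) b \<odot>\<^bsub>M\<^esub> x"
  by (simp_all add: underlying_module_def restrict_scalars_def)

text \<open>Sending a series to its multiplication operator respects sums, products and the unit, so
  the module laws are inherited from the action of the operators.\<close>

lemma underlying_module_module:
  assumes "cring A" "left_module (power_series_diff_ops A n) M"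
  shows "module (power_series A n) (underlying_module A n M)"
proof -
  interpret A: cring A by fact
  interpret D: left_module "power_series_diff_ops A n" M by fact
  show ?thesis
  proof (rule moduleI[OF A.power_series_cring])
    show "abelian_group (underlying_module A n M)"
    proof (rule abelian_groupI)
      fix x
      assume "x \<in> carrier (underlying_module A n M)"
      then show "\<exists>y\<in>carrier (underlying_module A n M).
          y \<oplus>\<^bsub>underlying_module A n M\<^esub> x = \<zero>\<^bsub>underlying_module A n M\<^esub>"
        by (intro bexI[of _ "\<ominus>\<^bsub>M\<^esub> x"]) (auto simp: underlying_module_simps D.M.l_neg)
    qed (auto simp: underlying_module_simps D.M.a_ac)
  qed (auto simp: underlying_module_simps A.mult_operator_closed A.mult_operator_add
      A.mult_operator_mult A.mult_operator_one
      intro: D.smult_closed D.smult_l_distr D.smult_r_distr D.smult_assoc D.smult_one)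
qed

theorem corollary0p7:
  fixes A :: "('a, 'x) ring_scheme"
    and n :: nat
    and M :: "((nat multiset \<Rightarrow> 'a) \<Rightarrow> (nat multiset \<Rightarrow> 'a), 'm, 'y) module_scheme"
  assumes "cring A"
    and "contains_rationals A"
    and "left_module (power_series_diff_ops A n) M"
    and "adically_complete (power_series A n) (variable_ideal A n) (underlying_module A n M)"
  shows "bij_betw
           (\<lambda>m. ideal_smult (variable_ideal A n) (underlying_module A n M)
                  +>\<^bsub>underlying_module A n M\<^esub> m)
           (horizontal A n M)
           (carrier (quotient_module (underlying_module A n M)
              (ideal_smult (variable_ideal A n) (underlying_module A n M))))"
proof -
  let ?B = "power_series A n" and ?I = "variable_ideal A n" and ?N = "underlying_module A n M"
  let ?D = "\<lambda>j x. partial_derivative A n j \<odot>\<^bsub>M\<^esub> x"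
  interpret A: cring A by fact
  interpret L: left_module "power_series_diff_ops A n" M by fact
  interpret N: module ?B ?N
    using assms(1,3) by (rule underlying_module_module)
  note I = A.variable_ideal_ideal[of n]
  interpret F: complete_filtered_module ?B ?N "adic_submodule ?B ?I ?N"
    using I assms(4) by (rule N.adically_complete_imp_complete_filtered)
  obtain c where c: "\<And>i. c i \<in> carrier A" "c 0 = \<one>\<^bsub>A\<^esub>"
    "\<And>i. [Suc i] \<cdot>\<^bsub>A\<^esub> c (Suc i) = \<ominus>\<^bsub>A\<^esub> c i"
    by (rule A.contains_rationals_factorials[OF assms(2)]) blast
  \<comment> \<open>For the sequence \<open>c\<close> in mind, \<open>p j i\<close> is (-t_j)^i /
    i!.\<close>
  define p :: "nat \<Rightarrow> nat \<Rightarrow> nat multiset \<Rightarrow> 'a"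
    where "p j i = A.monomial_series (replicate_mset i j) (c i)" for j i
  have F_1: "adic_submodule ?B ?I ?N 1 = ideal_smult ?I ?N"
    unfolding adic_submodule_def N.R.ideal_power_1[OF I] ..
  have D_closed: "?D j x \<in> carrier ?N" if "x \<in> carrier ?N" for j x
    using that L.smult_closed A.partial_derivative_in_diff_operators
    by (simp add: underlying_module_simps)
  have D_add: "?D j (x \<oplus>\<^bsub>?N\<^esub> y) = ?D j x \<oplus>\<^bsub>?N\<^esub> ?D j y"
    if "x \<in> carrier ?N" "y \<in> carrier ?N" for j x y
    using that L.smult_r_distr A.partial_derivative_in_diff_operators
    by (simp add: underlying_module_simps)
  \<comment> \<open>Associativity and left distributivity of the action transport the operator form
    of the Leibniz rule to \<open>M\<close>.\<close>
  have D_smult: "?D j (b \<odot>\<^bsub>?N\<^esub> x) = b \<odot>\<^bsub>?N\<^esub> ?D j x \<oplus>\<^bsub>?N\<^esub> partial_derivative A n j b \<odot>\<^bsub>?N\<^esub> x"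
    if "b \<in> carrier ?B" "x \<in> carrier ?N" for j b x
    using that
    by (simp add: underlying_module_simps L.smult_assoc[symmetric] L.smult_l_distr[symmetric]
        A.partial_derivative_mult_operator A.partial_derivative_in_diff_operators
        A.mult_operator_closed A.partial_derivative_closed)
  have D_commute: "?D i (?D j x) = ?D j (?D i x)" if "x \<in> carrier ?N" for i j x
    using that
    by (simp add: underlying_module_simps L.smult_assoc[symmetric]
        A.partial_derivative_in_diff_operators A.partial_derivative_operators_commute[of n i j])
  have "module_coordinates ?B ?N (adic_submodule ?B ?I ?N) n (partial_derivative A n) ?D
      (ring.indexed_var A) p"
  proof (intro module_coordinates.intro module_coordinates_axioms.intro
      F.complete_filtered_module_axioms)
    fix j
    assume j: "j \<in> {1..n}"
    then have set_mset: "set_mset (replicate_mset i j) \<subseteq> {1..n}" for i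
      by (simp add: set_mset_replicate_mset_subset)
    show "module_coordinate ?B ?N (adic_submodule ?B ?I ?N) (partial_derivative A n j) (?D j)
        (A.indexed_var j) (p j)"
    proof (intro module_coordinate.intro module_coordinate_axioms.intro
        F.complete_filtered_module_axioms A.partial_derivative_closed D_closed D_add D_smult)
      fix x k
      assume "x \<in> adic_submodule ?B ?I ?N (Suc k)"
      then show "?D j x \<in> adic_submodule ?B ?I ?N k"
        by (intro N.derivation_adic_submodule[OF I, where D = "?D j"
              and \<delta> = "partial_derivative A n j"] A.partial_derivative_closed
            A.partial_derivative_add A.partial_derivative_mult D_closed D_add D_smult)
    next
      show "A.indexed_var j \<in> carrier ?B"
        using j by (rule A.indexed_var_closed)
      show "partial_derivative A n j (A.indexed_var j) = \<one>\<^bsub>?B\<^esub>"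
        using A.partial_derivative_monomial[of "\<one>\<^bsub>A\<^esub>" "{#}" n j] j
        by (simp add: A.indexed_var_eq_monomial power_series_simps(3) A.indexed_const_eq_monomial)
      show "p j i \<in> carrier ?B" for i
        unfolding p_def by (rule A.monomial_series_closed[OF c(1) set_mset])
      show "p j 0 = \<one>\<^bsub>?B\<^esub>"
        by (simp add: p_def c(2) power_series_simps(3) A.indexed_const_eq_monomial)
      \<comment> \<open>Differentiating t_j^(i+1) gives the factor i + 1, and the recurrence for
        \<open>c\<close> turns (i+1) c_(i+1) into -c_i.\<close>
      show "partial_derivative A n j (p j (Suc i)) = \<ominus>\<^bsub>?B\<^esub> p j i" for i
        using A.partial_derivative_monomial[OF c(1)[of "Suc i"] set_mset[of i] j] c(3)[of i]
        by (simp add: p_def A.monomial_series_minus[OF c(1) set_mset] del: A.add.nat_pow_Suc)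
      \<comment> \<open>The same recurrence read backwards: the coefficient c_i of t_j^(i+1) is
        -(i+1) c_(i+1).\<close>
      show "p j i \<otimes>\<^bsub>?B\<^esub> A.indexed_var j = \<ominus>\<^bsub>?B\<^esub> ([Suc i] \<cdot>\<^bsub>?B\<^esub> p j (Suc i))" for i
      proof -
        have "p j i \<otimes>\<^bsub>?B\<^esub> A.indexed_var j = A.monomial_series (replicate_mset (Suc i) j) (c i)"
          unfolding p_def A.indexed_var_eq_monomial using j c(1)[of i]
          by (subst A.monomial_series_mult_monomial) auto
        moreover have "[Suc i] \<cdot>\<^bsub>?B\<^esub> p j (Suc i) =
            A.monomial_series (replicate_mset (Suc i) j) (\<ominus>\<^bsub>A\<^esub> c i)"
          unfolding p_def A.monomial_series_add_pow[OF c(1)] c(3) ..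
        ultimately show ?thesis
          using c(1)[of i] A.monomial_series_minus[OF _ set_mset, of "\<ominus>\<^bsub>A\<^esub> c i" "Suc i"] by simp
      qed
      show "p j i \<odot>\<^bsub>?N\<^esub> x \<in> adic_submodule ?B ?I ?N i" if "x \<in> carrier ?N" for x i
        unfolding adic_submodule_def p_def
        using A.monomial_series_in_ideal_power[OF j c(1)] that by (rule N.ideal_smultI)
    qed
    fix i
    assume i: "i \<in> {1..n}" "j \<noteq> i"
    show "partial_derivative A n j (A.indexed_var i) = \<zero>\<^bsub>?B\<^esub>"
      unfolding A.indexed_var_eq_monomial using i
      by (intro A.partial_derivative_monomial_zero) auto
    show "partial_derivative A n j (p i k) = \<zero>\<^bsub>?B\<^esub>" for k
      unfolding p_def using i c(1)
      by (intro A.partial_derivative_monomial_zero) (auto dest: in_replicate_mset[THEN iffD1])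
  next
    show "?D i (?D j x) = ?D j (?D i x)" if "x \<in> carrier ?N" for i j x
      using that by (rule D_commute)
    \<comment> \<open>The variables generate b as an ideal, so bM is the additive group generated by
      the products t_j x; here only the description of these generators is adapted.\<close>
    have gens: "{s \<odot>\<^bsub>?N\<^esub> x | s x. s \<in> A.indexed_var ` {1..n} \<and> x \<in> carrier ?N} =
        {A.indexed_var j \<odot>\<^bsub>?N\<^esub> x | j x. j \<in> {1..n} \<and> x \<in> carrier ?N}"
      by blast
    have "A.indexed_var ` {1..n} \<subseteq> carrier ?B"
      using A.indexed_var_closed by blast
    from N.ideal_smult_genideal_subset[OF this] show "adic_submodule ?B ?I ?N 1 \<subseteq> generate (add_monoid ?N)
        {A.indexed_var j \<odot>\<^bsub>?N\<^esub> x | j x. j \<in> {1..n} \<and> x \<in> carrier ?N}"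
      unfolding F_1 unfolding variable_ideal_def gens .
  qed
  then have "bij_betw (\<lambda>m. ideal_smult ?I ?N +>\<^bsub>?N\<^esub> m)
      {m \<in> carrier ?N. \<forall>j\<in>{1..n}. ?D j m = \<zero>\<^bsub>?N\<^esub>} (a_rcosets\<^bsub>?N\<^esub> (ideal_smult ?I ?N))"
    unfolding F_1[symmetric] by (rule module_coordinates.bij_betw_horizontal)
  then show ?thesis
    by (simp add: horizontal_def quotient_module_def underlying_module_simps)
qed

end
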